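(* Let $n,p$ be positive integers. The Riemannian manifold $(\mathbb{H}^{n\times n\times p}_{++},g)$, where $g_{\mathcal{P}}(\mathcal{X},\mathcal{Y})=\operatorname{tr}(\mathcal{P}^{-1}*\mathcal{X}*\mathcal{P}^{-1}*\mathcal{Y})$, has nonpositive (sectional) curvature.
   Context: A tensor $\mathcal{A}\in\mathbb{C}^{m\times n\times p}$ has frontal slices $A^{(1)},\dots,A^{(p)}\in\mathbb{C}^{m\times n}$. $\operatorname{bcirc}(\mathcal{A})\in\mathbb{C}^{mp\times np}$ is the block circulant matrix whose $(j,l)$ block is $A^{(((j-l)\bmod p)+1)}$ (first block column $A^{(1)},\dots,A^{(p)}$); $\operatorname{unfold}(\mathcal{A})$ is the block column $A^{(1)},\dots,A^{(p)}$, and $\operatorname{fold}$ is its inverse. The T-product is $\mathcal{A}*\mathcal{B}=\operatorname{fold}(\operatorname{bcirc}(\mathcal{A})\cdot\operatorname{unfold}(\mathcal{B}))$; inverses are with respect to $*$ and the identity tensor $\mathcal{I}_{n,p}$ (first frontal slice $I_n$, others zero). The T-conjugate transpose $\mathcal{A}^H$ has frontal slices $(A^{(1)})^H,(A^{(p)})^H,\dots,(A^{(2)})^H$. $\mathbb{H}^{n\times n\times p}$ is the real vector space of T-Hermitian tensors ($\mathcal{A}\in\mathbb{C}^{n\times n\times p}$, $\mathcal{A}^H=\mathcal{A}$). With $\langle\mathcal{A},\mathcal{B}\rangle=\sum_{i,j,k}\overline{a_{ijk}}b_{ijk}$, $\mathbb{H}^{n\times n\times p}_{++}$ is the set of T-positive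 definite tensors, i.e. $\mathcal{A}\in\mathbb{H}^{n\times n\times p}$ with $\langle\mathcal{X},\mathcal{A}*\mathcal{X}\rangle>0$ for all nonzero $\mathcal{X}\in\mathbb{C}^{n\times1\times p}$ (equivalently, $\operatorname{bcirc}(\mathcal{A})$ is Hermitian positive definite). It is an open convex cone in $\mathbb{H}^{n\times n\times p}$ (topology of the Frobenius norm), hence a smooth manifold with $T_{\mathcal{P}}\mathbb{H}^{n\times n\times p}_{++}=\mathbb{H}^{n\times n\times p}$. The trace is $\operatorname{tr}(\mathcal{A})=\operatorname{tr}(\operatorname{bcirc}(\mathcal{A}))$. *)

theory Defs
  imports "HOL-Analysis.Analysis" "Berlekamp_Zassenhaus.Finite_Field"
begin

section \<open>Riemannian geometry on an open subset of a finite-dimensional real vector space\<close>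

text \<open>
  Throughout, \<open>V\<close> is a linear subspace of a Euclidean space and \<open>U\<close> is a (relatively) open subset
  of \<open>V\<close>, regarded as a smooth manifold with the tangent space \<open>V\<close> at every point. Functions and
  vector fields on \<open>U\<close> are total functions of which only the values on \<open>U\<close> matter.
\<close>

definition dirderiv :: "('a::real_normed_vector \<Rightarrow> 'b::real_normed_vector) \<Rightarrow> 'a \<Rightarrow> 'a \<Rightarrow> 'b" where
  "dirderiv f v P = vector_derivative (\<lambda>t::real. f (P + t *\<^sub>R v)) (at 0)"

text \<open>
  \<open>f\<close> is of class \<open>C\<^sup>k\<close> on \<open>U\<close> when its iterated directional derivatives along \<open>V\<close> up to order \<open>k\<close>
  exist and are continuous.
\<close>

primrec Ck_on :: "nat \<Rightarrow> 'a::euclidean_space set \<Rightarrow> 'a set \<Rightarrow> ('a \<Rightarrow> 'b::real_normed_vector) \<Rightarrow> bool" where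
  "Ck_on 0 V U f \<longleftrightarrow> continuous_on U f"
| "Ck_on (Suc k) V U f \<longleftrightarrow> continuous_on U f \<and>
     (\<forall>v\<in>V. (\<forall>P\<in>U. (\<lambda>t::real. f (P + t *\<^sub>R v)) differentiable (at 0)) \<and> Ck_on k V U (dirderiv f v))"

definition smooth_on :: "'a::euclidean_space set \<Rightarrow> 'a set \<Rightarrow> ('a \<Rightarrow> 'b::real_normed_vector) \<Rightarrow> bool" where
  "smooth_on V U f \<longleftrightarrow> (\<forall>k. Ck_on k V U f)"

definition vector_fields :: "'a::euclidean_space set \<Rightarrow> 'a set \<Rightarrow> ('a \<Rightarrow> 'a) set" where
  "vector_fields V U = {X. smooth_on V U X \<and> (\<forall>P\<in>U. X P \<in> V)}"

definition lie_bracket :: "('a::euclidean_space \<Rightarrow> 'a) \<Rightarrow> ('a \<Rightarrow> 'a) \<Rightarrow> 'a \<Rightarrow> 'a" where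
  "lie_bracket X Y P = dirderiv Y (X P) P - dirderiv X (Y P) P"

definition riemannian_manifold ::
    "'a::euclidean_space set \<Rightarrow> 'a set \<Rightarrow> ('a \<Rightarrow> 'a \<Rightarrow> 'a \<Rightarrow> real) \<Rightarrow> bool" where
  "riemannian_manifold V U g \<longleftrightarrow>
     subspace V \<and> openin (top_of_set V) U \<and>
     (\<forall>P\<in>U.
        (\<forall>x\<in>V. \<forall>y\<in>V. \<forall>z\<in>V. g P (x + y) z = g P x z + g P y z) \<and>
        (\<forall>c. \<forall>x\<in>V. \<forall>y\<in>V. g P (c *\<^sub>R x) y = c * g P x y) \<and>
        (\<forall>x\<in>V. \<forall>y\<in>V. g P x y = g P y x) \<and>
        (\<forall>x\<in>V. x \<noteq> 0 \<longrightarrow> g P x x > 0)) \<and>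
     (\<forall>x\<in>V. \<forall>y\<in>V. smooth_on V U (\<lambda>P. g P x y))"

definition affine_connection ::
    "'a::euclidean_space set \<Rightarrow> 'a set \<Rightarrow> (('a \<Rightarrow> 'a) \<Rightarrow> ('a \<Rightarrow> 'a) \<Rightarrow> 'a \<Rightarrow> 'a) \<Rightarrow> bool" where
  "affine_connection V U D \<longleftrightarrow>
     (\<forall>X\<in>vector_fields V U. \<forall>Y\<in>vector_fields V U. D X Y \<in> vector_fields V U) \<and>
     (\<forall>X\<in>vector_fields V U. \<forall>Y\<in>vector_fields V U. \<forall>Z\<in>vector_fields V U. \<forall>P\<in>U.
        D (\<lambda>Q. X Q + Y Q) Z P = D X Z P + D Y Z P \<and>
        D X (\<lambda>Q. Y Q + Z Q) P = D X Y P + D X Z P) \<and>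
     (\<forall>f :: 'a \<Rightarrow> real. smooth_on V U f \<longrightarrow>
        (\<forall>X\<in>vector_fields V U. \<forall>Y\<in>vector_fields V U. \<forall>P\<in>U.
           D (\<lambda>Q. f Q *\<^sub>R X Q) Y P = f P *\<^sub>R D X Y P \<and>
           D X (\<lambda>Q. f Q *\<^sub>R Y Q) P = dirderiv f (X P) P *\<^sub>R Y P + f P *\<^sub>R D X Y P))"

definition is_levi_civita ::
    "'a::euclidean_space set \<Rightarrow> 'a set \<Rightarrow> ('a \<Rightarrow> 'a \<Rightarrow> 'a \<Rightarrow> real) \<Rightarrow>
      (('a \<Rightarrow> 'a) \<Rightarrow> ('a \<Rightarrow> 'a) \<Rightarrow> 'a \<Rightarrow> 'a) \<Rightarrow> bool" where
  "is_levi_civita V U g D \<longleftrightarrow>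
     affine_connection V U D \<and>
     (\<forall>X\<in>vector_fields V U. \<forall>Y\<in>vector_fields V U. \<forall>P\<in>U.
        D X Y P - D Y X P = lie_bracket X Y P) \<and>
     (\<forall>X\<in>vector_fields V U. \<forall>Y\<in>vector_fields V U. \<forall>Z\<in>vector_fields V U. \<forall>P\<in>U.
        dirderiv (\<lambda>Q. g Q (Y Q) (Z Q)) (X P) P = g P (D X Y P) (Z P) + g P (Y P) (D X Z P))"

text \<open>
  By the fundamental theorem of Riemannian geometry, such a connection exists on a Riemannian
  manifold, and (by the Koszul formula) its values on \<open>U\<close> are uniquely determined.
\<close>

definition levi_civita ::
    "'a::euclidean_space set \<Rightarrow> 'a set \<Rightarrow> ('a \<Rightarrow> 'a \<Rightarrow> 'a \<Rightarrow> real) \<Rightarrow>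
      ('a \<Rightarrow> 'a) \<Rightarrow> ('a \<Rightarrow> 'a) \<Rightarrow> 'a \<Rightarrow> 'a" where
  "levi_civita V U g = (SOME D. is_levi_civita V U g D)"

text \<open>\<open>R(X,Y)Z = \<nabla>\<^sub>X\<nabla>\<^sub>YZ - \<nabla>\<^sub>Y\<nabla>\<^sub>XZ - \<nabla>\<^bsub>[X,Y]\<^esub>Z\<close>\<close>

definition riemann_curvature ::
    "'a::euclidean_space set \<Rightarrow> 'a set \<Rightarrow> ('a \<Rightarrow> 'a \<Rightarrow> 'a \<Rightarrow> real) \<Rightarrow>
      ('a \<Rightarrow> 'a) \<Rightarrow> ('a \<Rightarrow> 'a) \<Rightarrow> ('a \<Rightarrow> 'a) \<Rightarrow> 'a \<Rightarrow> 'a" where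
  "riemann_curvature V U g X Y Z P =
     (let D = levi_civita V U g
      in D X (D Y Z) P - D Y (D X Z) P - D (lie_bracket X Y) Z P)"

text \<open>
  The sectional curvature at \<open>P\<close> of the plane spanned by \<open>X P\<close> and \<open>Y P\<close>; with these sign
  conventions round spheres have positive curvature.
\<close>

definition sectional_curvature ::
    "'a::euclidean_space set \<Rightarrow> 'a set \<Rightarrow> ('a \<Rightarrow> 'a \<Rightarrow> 'a \<Rightarrow> real) \<Rightarrow>
      ('a \<Rightarrow> 'a) \<Rightarrow> ('a \<Rightarrow> 'a) \<Rightarrow> 'a \<Rightarrow> real" where
  "sectional_curvature V U g X Y P =
     g P (riemann_curvature V U g X Y Y P) (X P) /
     (g P (X P) (X P) * g P (Y P) (Y P) - (g P (X P) (Y P))\<^sup>2)"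

definition nonpositive_curvature ::
    "'a::euclidean_space set \<Rightarrow> 'a set \<Rightarrow> ('a \<Rightarrow> 'a \<Rightarrow> 'a \<Rightarrow> real) \<Rightarrow> bool" where
  "nonpositive_curvature V U g \<longleftrightarrow>
     (\<forall>P\<in>U. \<forall>X\<in>vector_fields V U. \<forall>Y\<in>vector_fields V U.
        X P \<noteq> Y P \<and> independent {X P, Y P} \<longrightarrow> sectional_curvature V U g X Y P \<le> 0)"


section \<open>Tensors and the T-product\<close>

text \<open>
  A third-order tensor of size \<open>m \<times> n \<times> p\<close> is the family of its frontal slices. The slices are
  indexed by \<open>'p mod_ring\<close>, the integers modulo \<open>p = CARD('p)\<close>: \<open>\<A> $ k $ i $ j\<close> is the \<open>(i,j)\<close> entry
  of the slice \<open>A\<^bsup>(k+1)\<^esup>\<close>. The norm of this type is the Frobenius norm. Rows and columns of block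
  matrices are indexed by pairs (block, position in the block).
\<close>

type_synonym ('m, 'n, 'p) tensor = "((complex ^ 'n) ^ 'm) ^ 'p mod_ring"

definition bcirc :: "('m::finite, 'n::finite, 'p::finite) tensor \<Rightarrow>
    complex ^ ('p mod_ring \<times> 'n) ^ ('p mod_ring \<times> 'm)" where
  "bcirc A = (\<chi> r c. A $ (fst r - fst c) $ snd r $ snd c)"

definition unfold_tensor :: "('m::finite, 'n::finite, 'p::finite) tensor \<Rightarrow>
    complex ^ 'n ^ ('p mod_ring \<times> 'm)" where
  "unfold_tensor A = (\<chi> r. A $ fst r $ snd r)"

definition fold_tensor :: "complex ^ 'n ^ ('p mod_ring \<times> 'm) \<Rightarrow>
    ('m::finite, 'n::finite, 'p::finite) tensor" where
  "fold_tensor M = (\<chi> k i. M $ (k, i))"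

definition tprod :: "('m::finite, 'n::finite, 'p::finite) tensor \<Rightarrow> ('n, 'q::finite, 'p) tensor \<Rightarrow>
    ('m, 'q, 'p) tensor"  (infixl \<open>\<star>\<close> 70) where
  "A \<star> B = fold_tensor (bcirc A ** unfold_tensor B)"

definition tident :: "('n::finite, 'n, 'p::finite) tensor" where
  "tident = (\<chi> k. if k = 0 then mat 1 else 0)"

definition tinv :: "('n::finite, 'n, 'p::finite) tensor \<Rightarrow> ('n, 'n, 'p) tensor" where
  "tinv A = (SOME B. A \<star> B = tident \<and> B \<star> A = tident)"

text \<open>The frontal slices of \<open>\<A>\<^sup>H\<close> are \<open>(A\<^bsup>(1)\<^esup>)\<^sup>H, (A\<^bsup>(p)\<^esup>)\<^sup>H, \<dots>, (A\<^bsup>(2)\<^esup>)\<^sup>H\<close>, hence the index \<open>- k\<close>.\<close>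

definition tadjoint :: "('m::finite, 'n::finite, 'p::finite) tensor \<Rightarrow> ('n, 'm, 'p) tensor" where
  "tadjoint A = (\<chi> k i j. cnj (A $ (- k) $ j $ i))"

definition ttrace :: "('n::finite, 'n, 'p::finite) tensor \<Rightarrow> complex" where
  "ttrace A = trace (bcirc A)"

definition tinner :: "('m::finite, 'n::finite, 'p::finite) tensor \<Rightarrow> ('m, 'n, 'p) tensor \<Rightarrow> complex" where
  "tinner A B = (\<Sum>k\<in>UNIV. \<Sum>i\<in>UNIV. \<Sum>j\<in>UNIV. cnj (A $ k $ i $ j) * B $ k $ i $ j)"

definition T_Hermitian :: "('n::finite, 'n, 'p::finite) tensor set" where
  "T_Hermitian = {A. tadjoint A = A}"

definition T_posdef :: "('n::finite, 'n, 'p::finite) tensor set" where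
  "T_posdef = {A \<in> T_Hermitian. \<forall>X :: ('n, 1, 'p) tensor. X \<noteq> 0 \<longrightarrow>
      tinner X (A \<star> X) \<in> \<real> \<and> Re (tinner X (A \<star> X)) > 0}"

text \<open>The trace below is real for T-positive definite \<open>P\<close> and T-Hermitian \<open>X\<close>, \<open>Y\<close>.\<close>

definition trace_metric :: "('n::finite, 'n, 'p::finite) tensor \<Rightarrow> ('n, 'n, 'p) tensor \<Rightarrow>
    ('n, 'n, 'p) tensor \<Rightarrow> real" where
  "trace_metric P X Y = Re (ttrace (tinv P \<star> X \<star> tinv P \<star> Y))"

end

theory Submission
  imports Defs
begin

text \<open>
  Nothing in the geometry depends on tensors. It uses a finite-dimensional real algebra with unit and with an
  inner product for which multiplication by \<open>x\<close> has multiplication by \<open>star x\<close> as its adjoint, on the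
  left and on the right (\<open>hilbert_algebra\<close>). Tensors under the T-product form such an algebra, because \<open>bcirc\<close>
  is an injective homomorphism into matrices that respects adjoints and, up to the factor \<open>p\<close>, the Frobenius
  inner product; T-positive definite tensors are then the positive definite elements of that algebra.

  Let \<open>B\<close> be the inverse of the point \<open>P\<close>. Differentiating the metric \<open>tr (B x B y)\<close>
  shows that \<open>\<nabla>\<^sub>X Y = dY(X) - (X B Y + Y B X) / 2\<close> is torsion free and metric (\<open>is_levi_civita_connection\<close>); by
  the uniqueness of such a connection (\<open>levi_civita_unique\<close>) it computes the curvature. Second derivatives of
  the fields cancel by symmetry (\<open>dirderiv_commute\<close>), and what remains is algebraic: writing \<open>x \<circ> y = x B y\<close>,
  the curvature is \<open>R(x, y) z = - [[x, y], z] / 4\<close> (\<open>riemann_curvature_metric\<close>). Pairing \<open>R(x, y) y\<close> with \<open>x\<close>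
  and permuting cyclically under the trace gives \<open>- tr (B w\<^sup>* B w) / 4\<close>, up to the normalization
  of the metric, with the commutator \<open>w = [x, y]\<close>.

  The sign thus comes down to one inequality, \<open>tr (B w\<^sup>* B w) > 0\<close> for positive definite \<open>B\<close> and nonzero
  \<open>w\<close> (\<open>sandwich_pos\<close>). For Hermitian \<open>w\<close> it says that the metric is positive definite.

  Smoothness is given by iterated directional derivatives along constant directions, so the facts of
  differential calculus that enter are proved from that definition: linearity in the direction, symmetry of
  second derivatives, and the derivative of a function along a vector field.
\<close>

section \<open>Directional calculus on an open part of a linear subspace\<close>

text \<open>
  A vector-valued function has no mean value theorem; this inequality replaces it, both for the additivity
  of \<open>dirderiv\<close> in the direction and for the symmetry of second derivatives.
\<close>

lemma mean_value_linearization_bound: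
  fixes f :: "real \<Rightarrow> 'b::real_normed_vector"
  assumes deriv: "\<And>s. s \<in> closed_segment 0 t \<Longrightarrow> (f has_vector_derivative f' s) (at s)"
    and bound: "\<And>s. s \<in> closed_segment 0 t \<Longrightarrow> norm (f' s - c) \<le> e"
  shows "norm (f t - f 0 - t *\<^sub>R c) \<le> e * \<bar>t\<bar>"
proof -
  define h where "h s = f s - s *\<^sub>R c" for s
  have "norm (h t - h 0) \<le> e * norm (t - 0)"
  proof (rule differentiable_bound[where S = "closed_segment 0 t" and f' = "\<lambda>s x. x *\<^sub>R (f' s - c)"])
    show "(h has_derivative (\<lambda>x. x *\<^sub>R (f' s - c))) (at s within closed_segment 0 t)"
      if "s \<in> closed_segment 0 t" for s
      using has_vector_derivative_diff[OF deriv[OF that]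
          bounded_linear.has_vector_derivative[OF bounded_linear_scaleR_left has_vector_derivative_id]]
      unfolding h_def has_vector_derivative_def[symmetric] scaleR_one
      by (rule has_vector_derivative_at_within)
    show "onorm (\<lambda>x. x *\<^sub>R (f' s - c)) \<le> e" if "s \<in> closed_segment 0 t" for s
      using bound[OF that] by (intro onorm_le) (simp add: mult.commute[of e] mult_left_mono)
  qed auto
  then show ?thesis
    by (simp add: h_def algebra_simps)
qed

text \<open>
  In this form a limit of difference quotients can be taken inside a closed subspace, and the
  derivative of the inverse can be read off from the resolvent identity.
\<close>

lemma has_vector_derivative_iff_quotient:
  "(f has_vector_derivative D) (at 0) \<longleftrightarrow> ((\<lambda>t::real. (f t - f 0) /\<^sub>R t) \<longlongrightarrow> D) (at 0)"
proof -
  have eq: "norm (f t - f 0 - t *\<^sub>R D) / norm t = norm ((f t - f 0) /\<^sub>R t - D)" if "t \<noteq> 0" for t :: real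
  proof -
    have "(f t - f 0) /\<^sub>R t - D = inverse t *\<^sub>R (f t - f 0 - t *\<^sub>R D)"
      using that by (simp add: scaleR_diff_right)
    then show ?thesis by (simp add: divide_inverse mult.commute abs_inverse)
  qed
  have "(f has_vector_derivative D) (at 0) \<longleftrightarrow> ((\<lambda>t. norm (f t - f 0 - t *\<^sub>R D) / norm t) \<longlongrightarrow> 0) (at 0)"
    by (simp add: has_vector_derivative_def has_derivative_at bounded_linear_scaleR_left)
  also have "\<dots> \<longleftrightarrow> ((\<lambda>t. norm ((f t - f 0) /\<^sub>R t - D)) \<longlongrightarrow> 0) (at 0)"
    by (rule LIM_cong) (use eq in auto)
  also have "\<dots> \<longleftrightarrow> ((\<lambda>t. (f t - f 0) /\<^sub>R t) \<longlongrightarrow> D) (at 0)"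
    by (simp add: tendsto_norm_zero_iff LIM_zero_iff)
  finally show ?thesis .
qed

abbreviation has_dirderiv ::
    "('a::real_normed_vector \<Rightarrow> 'b::real_normed_vector) \<Rightarrow> 'b \<Rightarrow> 'a \<Rightarrow> 'a \<Rightarrow> bool" where
  "has_dirderiv f D v P \<equiv> ((\<lambda>t::real. f (P + t *\<^sub>R v)) has_vector_derivative D) (at 0)"

lemma dirderiv_eqI: "has_dirderiv f D v P \<Longrightarrow> dirderiv f v P = D"
  unfolding dirderiv_def by (rule vector_derivative_at)

lemma has_dirderiv_scaleR:
  assumes "has_dirderiv f D v P"
  shows "has_dirderiv f (c *\<^sub>R D) (c *\<^sub>R v) P"
proof -
  have "((\<lambda>t. f (P + t *\<^sub>R v)) \<circ> (\<lambda>t. t * c) has_vector_derivative c *\<^sub>R D) (at 0)"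
    by (rule vector_diff_chain_at) (use assms in \<open>auto intro!: derivative_eq_intros\<close>)
  then show ?thesis by (simp add: o_def)
qed

lemma has_dirderiv_line:
  assumes "has_dirderiv f D v (P + s *\<^sub>R v)"
  shows "((\<lambda>t. f (P + t *\<^sub>R v)) has_vector_derivative D) (at s)"
proof -
  have "((\<lambda>t. f (P + s *\<^sub>R v + t *\<^sub>R v)) \<circ> (\<lambda>t. t - s) has_vector_derivative 1 *\<^sub>R D) (at s)"
    by (rule vector_diff_chain_at) (use assms in \<open>auto intro!: derivative_eq_intros\<close>)
  then show ?thesis by (simp add: o_def algebra_simps)
qed

locale linear_domain =
  fixes V U :: "'a::euclidean_space set"
  assumes subspace_V: "subspace V" and openin_U: "openin (top_of_set V) U"
begin

lemma U_subset_V: "U \<subseteq> V"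
  using openin_imp_subset[OF openin_U] .

lemma ball_in_U:
  assumes "P \<in> U"
  obtains e where "e > 0" "\<And>v. v \<in> V \<Longrightarrow> norm v < e \<Longrightarrow> P + v \<in> U"
proof -
  obtain e where e: "e > 0" "\<And>x. x \<in> V \<Longrightarrow> dist x P < e \<Longrightarrow> x \<in> U"
    using openin_U assms unfolding openin_euclidean_subtopology_iff by blast
  show thesis
  proof (rule that[OF e(1)])
    fix v assume "v \<in> V" "norm v < e"
    moreover have "P \<in> V" using assms U_subset_V by auto
    ultimately show "P + v \<in> U"
      by (intro e(2)) (auto simp: subspace_add[OF subspace_V] dist_norm)
  qed
qed

lemma line_near_in_U:
  assumes "P \<in> U" "v \<in> V"
  obtains S where "open S" "(0::real) \<in> S" "\<And>t. t \<in> S \<Longrightarrow> P + t *\<^sub>R v \<in> U"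
proof -
  obtain e where e: "e > 0" "\<And>v. v \<in> V \<Longrightarrow> norm v < e \<Longrightarrow> P + v \<in> U"
    using ball_in_U[OF assms(1)] by blast
  show thesis
  proof (rule that[of "{t. norm (t *\<^sub>R v) < e}"])
    show "open {t. norm (t *\<^sub>R v) < e}"
      by (intro open_Collect_less continuous_intros)
    show "P + t *\<^sub>R v \<in> U" if "t \<in> {t. norm (t *\<^sub>R v) < e}" for t
      using that assms(2) by (auto intro!: e(2) simp: subspace_scale[OF subspace_V])
  qed (use e(1) in auto)
qed

text \<open>
  A line through a point of \<open>U\<close> with direction in \<open>V\<close> stays in \<open>U\<close> for a short time because \<open>U\<close> is
  relatively open. Hence derivatives see only the values on \<open>U\<close>, although functions are total.
\<close>

lemma has_dirderiv_cong:
  assumes "P \<in> U" "v \<in> V" and eq: "\<And>Q. Q \<in> U \<Longrightarrow> f Q = g Q" and f: "has_dirderiv f D v P"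
  shows "has_dirderiv g D v P"
proof -
  obtain S where S: "open S" "(0::real) \<in> S" "\<And>t. t \<in> S \<Longrightarrow> P + t *\<^sub>R v \<in> U"
    using line_near_in_U[OF assms(1,2)] by blast
  show ?thesis
    by (rule has_vector_derivative_transform_within_open[OF f S(1,2)]) (use eq S(3) in auto)
qed

lemma differentiable_line_iff:
  "(\<lambda>t::real. f (P + t *\<^sub>R v)) differentiable (at 0) \<longleftrightarrow> has_dirderiv f (dirderiv f v P) v P"
  unfolding dirderiv_def by (rule vector_derivative_works)

lemma dirderiv_cong:
  assumes "P \<in> U" "v \<in> V" and eq: "\<And>Q. Q \<in> U \<Longrightarrow> f Q = g Q"
  shows "dirderiv f v P = dirderiv g v P"
proof -
  have "has_dirderiv f D v P \<longleftrightarrow> has_dirderiv g D v P" for D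
    using has_dirderiv_cong[OF assms(1,2), of f g D] has_dirderiv_cong[OF assms(1,2), of g f D] eq
    by fastforce
  then show ?thesis unfolding dirderiv_def vector_derivative_def by simp
qed

lemma Ck_on_cong:
  assumes "\<And>P. P \<in> U \<Longrightarrow> f P = g P" "Ck_on k V U f"
  shows "Ck_on k V U g"
  using assms
proof (induction k arbitrary: f g)
  case 0
  then show ?case using continuous_on_cong[of U U f g] by simp
next
  case (Suc k)
  have "continuous_on U g"
    using Suc.prems continuous_on_cong[of U U f g] by simp
  moreover have "(\<lambda>t::real. g (P + t *\<^sub>R v)) differentiable (at 0)" if "v \<in> V" "P \<in> U" for v P
  proof -
    have "has_dirderiv f (dirderiv f v P) v P"
      using Suc.prems(2) that unfolding differentiable_line_iff[symmetric] by simp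
    from has_dirderiv_cong[OF that(2,1) _ this, of g] have "has_dirderiv g (dirderiv f v P) v P"
      using Suc.prems(1) by simp
    then show ?thesis by (auto simp: differentiable_def has_vector_derivative_def)
  qed
  moreover have "Ck_on k V U (dirderiv g v)" if "v \<in> V" for v
  proof (rule Suc.IH)
    show "dirderiv f v P = dirderiv g v P" if "P \<in> U" for P
      by (rule dirderiv_cong[OF that \<open>v \<in> V\<close> Suc.prems(1)])
  qed (use Suc.prems that in simp)
  ultimately show ?case by simp
qed

text \<open>
  Smoothness is proved by exhibiting derivatives: \<open>dirderiv\<close> may be replaced by any formula
  for it that is valid on \<open>U\<close>.
\<close>

lemma Ck_on_SucI:
  assumes "continuous_on U f"
    and "\<And>v P. v \<in> V \<Longrightarrow> P \<in> U \<Longrightarrow> has_dirderiv f (f' v P) v P"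
    and "\<And>v. v \<in> V \<Longrightarrow> Ck_on k V U (f' v)"
  shows "Ck_on (Suc k) V U f"
proof -
  have "(\<lambda>t::real. f (P + t *\<^sub>R v)) differentiable (at 0)" if "v \<in> V" "P \<in> U" for v P
    using assms(2)[OF that] by (auto simp: differentiable_def has_vector_derivative_def)
  moreover have "Ck_on k V U (dirderiv f v)" if "v \<in> V" for v
    by (rule Ck_on_cong[OF _ assms(3)[OF that]]) (rule dirderiv_eqI[OF assms(2)[OF that], symmetric])
  ultimately show ?thesis using assms(1) by simp
qed

lemma Ck_on_Suc_has_dirderiv:
  "Ck_on (Suc k) V U f \<Longrightarrow> v \<in> V \<Longrightarrow> P \<in> U \<Longrightarrow> has_dirderiv f (dirderiv f v P) v P"
  unfolding differentiable_line_iff[symmetric] by simp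

lemma Ck_on_SucD: "Ck_on (Suc k) V U f \<Longrightarrow> Ck_on k V U f"
  by (induction k arbitrary: f) auto

lemma Ck_on_imp_continuous_on: "Ck_on k V U f \<Longrightarrow> continuous_on U f"
  by (cases k) auto

lemma Ck_on_const: "Ck_on k V U (\<lambda>P. c)"
proof (induction k arbitrary: c)
  case (Suc k)
  show ?case by (rule Ck_on_SucI[where f' = "\<lambda>v P. 0"]) (use Suc in auto)
qed auto

lemma Ck_on_bounded_linear:
  assumes "bounded_linear h" "Ck_on k V U f"
  shows "Ck_on k V U (\<lambda>P. h (f P))"
  using assms(2)
proof (induction k arbitrary: f)
  case 0
  then show ?case using bounded_linear.continuous_on[OF assms(1)] by auto
next
  case (Suc k)
  show ?case
  proof (rule Ck_on_SucI[where f' = "\<lambda>v P. h (dirderiv f v P)"])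
    show "has_dirderiv (\<lambda>P. h (f P)) (h (dirderiv f v P)) v P" if "v \<in> V" "P \<in> U" for v P
      using bounded_linear.has_vector_derivative[OF assms(1) Ck_on_Suc_has_dirderiv[OF Suc.prems that]] .
  qed (use Suc bounded_linear.continuous_on[OF assms(1)] in auto)
qed

lemma Ck_on_add:
  assumes "Ck_on k V U f" "Ck_on k V U g"
  shows "Ck_on k V U (\<lambda>P. f P + g P)"
  using assms
proof (induction k arbitrary: f g)
  case (Suc k)
  show ?case
  proof (rule Ck_on_SucI[where f' = "\<lambda>v P. dirderiv f v P + dirderiv g v P"])
    show "has_dirderiv (\<lambda>P. f P + g P) (dirderiv f v P + dirderiv g v P) v P"
      if "v \<in> V" "P \<in> U" for v P
      using Ck_on_Suc_has_dirderiv[OF Suc.prems(1) that] Ck_on_Suc_has_dirderiv[OF Suc.prems(2) that]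
      by (rule has_vector_derivative_add)
  qed (use Suc in \<open>auto intro!: continuous_intros\<close>)
qed (auto intro!: continuous_intros)

lemma Ck_on_bounded_bilinear:
  assumes h: "bounded_bilinear h" and "Ck_on k V U f" "Ck_on k V U g"
  shows "Ck_on k V U (\<lambda>P. h (f P) (g P))"
  using assms(2,3)
proof (induction k arbitrary: f g)
  case 0
  then show ?case using bounded_bilinear.continuous_on[OF h] by auto
next
  case (Suc k)
  show ?case
  proof (rule Ck_on_SucI[where f' = "\<lambda>v P. h (f P) (dirderiv g v P) + h (dirderiv f v P) (g P)"])
    show "has_dirderiv (\<lambda>P. h (f P) (g P)) (h (f P) (dirderiv g v P) + h (dirderiv f v P) (g P)) v P"
      if "v \<in> V" "P \<in> U" for v P
      using bounded_bilinear.has_vector_derivative[OF h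
          Ck_on_Suc_has_dirderiv[OF Suc.prems(1) that] Ck_on_Suc_has_dirderiv[OF Suc.prems(2) that]]
      by simp
    show "Ck_on k V U (\<lambda>P. h (f P) (dirderiv g v P) + h (dirderiv f v P) (g P))" if "v \<in> V" for v
      using Suc.prems that by (intro Ck_on_add Suc.IH Ck_on_SucD[of k f] Ck_on_SucD[of k g]) auto
  qed (use Suc bounded_bilinear.continuous_on[OF h] in auto)
qed

lemma smooth_on_imp_has_dirderiv:
  "smooth_on V U f \<Longrightarrow> v \<in> V \<Longrightarrow> P \<in> U \<Longrightarrow> has_dirderiv f (dirderiv f v P) v P"
  unfolding smooth_on_def using Ck_on_Suc_has_dirderiv by blast

lemma smooth_on_dirderiv: "smooth_on V U f \<Longrightarrow> v \<in> V \<Longrightarrow> smooth_on V U (dirderiv f v)"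
  unfolding smooth_on_def using Ck_on.simps(2) by blast

lemma smooth_on_imp_continuous_on: "smooth_on V U f \<Longrightarrow> continuous_on U f"
  unfolding smooth_on_def using Ck_on_imp_continuous_on by blast

lemma smooth_on_cong:
  "(\<And>P. P \<in> U \<Longrightarrow> f P = g P) \<Longrightarrow> smooth_on V U f \<Longrightarrow> smooth_on V U g"
  unfolding smooth_on_def using Ck_on_cong by blast

lemma smooth_on_const: "smooth_on V U (\<lambda>P. c)"
  unfolding smooth_on_def by (simp add: Ck_on_const)

lemma smooth_on_add: "smooth_on V U f \<Longrightarrow> smooth_on V U g \<Longrightarrow> smooth_on V U (\<lambda>P. f P + g P)"
  unfolding smooth_on_def by (simp add: Ck_on_add)

lemma smooth_on_bounded_linear:
  "bounded_linear h \<Longrightarrow> smooth_on V U f \<Longrightarrow> smooth_on V U (\<lambda>P. h (f P))"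
  unfolding smooth_on_def by (simp add: Ck_on_bounded_linear)

lemma smooth_on_bounded_bilinear:
  "bounded_bilinear h \<Longrightarrow> smooth_on V U f \<Longrightarrow> smooth_on V U g \<Longrightarrow> smooth_on V U (\<lambda>P. h (f P) (g P))"
  unfolding smooth_on_def by (simp add: Ck_on_bounded_bilinear)

lemma smooth_on_sum:
  "(\<And>i. i \<in> I \<Longrightarrow> smooth_on V U (f i)) \<Longrightarrow> smooth_on V U (\<lambda>P. \<Sum>i\<in>I. f i P)"
  by (induction I rule: infinite_finite_induct) (auto simp: smooth_on_const intro: smooth_on_add)

lemma smooth_on_diff: 
  assumes "smooth_on V U f" "smooth_on V U g" shows "smooth_on V U (\<lambda>P. f P - g P)"
  using smooth_on_add[OF assms(1) smooth_on_bounded_linear[OF bounded_linear_minus[OF bounded_linear_ident] assms(2)]]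
  by simp

lemma dirderiv_bounded_bilinear:
  assumes h: "bounded_bilinear h" and "smooth_on V U f" "smooth_on V U g" "v \<in> V" "P \<in> U"
  shows "dirderiv (\<lambda>P. h (f P) (g P)) v P = h (f P) (dirderiv g v P) + h (dirderiv f v P) (g P)"
  using bounded_bilinear.has_vector_derivative[OF h smooth_on_imp_has_dirderiv[OF assms(2,4,5)]
      smooth_on_imp_has_dirderiv[OF assms(3-5)]]
  by (auto intro: dirderiv_eqI)

lemma dirderiv_bounded_linear:
  assumes h: "bounded_linear h" and "smooth_on V U f" "v \<in> V" "P \<in> U"
  shows "dirderiv (\<lambda>P. h (f P)) v P = h (dirderiv f v P)"
  using bounded_linear.has_vector_derivative[OF h smooth_on_imp_has_dirderiv[OF assms(2-4)]]
  by (auto intro: dirderiv_eqI)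

lemma dirderiv_add:
  assumes "smooth_on V U f" "smooth_on V U g" "v \<in> V" "P \<in> U"
  shows "dirderiv (\<lambda>P. f P + g P) v P = dirderiv f v P + dirderiv g v P"
  using has_vector_derivative_add[OF smooth_on_imp_has_dirderiv[OF assms(1,3,4)]
      smooth_on_imp_has_dirderiv[OF assms(2-4)]]
  by (auto intro: dirderiv_eqI)

lemma dirderiv_sum:
  assumes "\<And>i. i \<in> I \<Longrightarrow> smooth_on V U (f i)" "v \<in> V" "P \<in> U"
  shows "dirderiv (\<lambda>P. \<Sum>i\<in>I. f i P) v P = (\<Sum>i\<in>I. dirderiv (f i) v P)"
  using smooth_on_imp_has_dirderiv[OF assms] by (intro dirderiv_eqI has_vector_derivative_sum) auto

lemma dirderiv_scaleR:
  assumes "smooth_on V U f" "v \<in> V" "P \<in> U"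
  shows "dirderiv f (c *\<^sub>R v) P = c *\<^sub>R dirderiv f v P"
  by (intro dirderiv_eqI has_dirderiv_scaleR smooth_on_imp_has_dirderiv assms)

lemma smooth_on_near:
  assumes "smooth_on V U f" "P \<in> U" "e > 0"
  obtains d where "d > 0"
    "\<And>v. v \<in> V \<Longrightarrow> norm v < d \<Longrightarrow> P + v \<in> U \<and> norm (f (P + v) - f P) \<le> e"
proof -
  obtain d1 where d1: "d1 > 0" "\<And>v. v \<in> V \<Longrightarrow> norm v < d1 \<Longrightarrow> P + v \<in> U"
    using ball_in_U[OF assms(2)] by blast
  obtain d2 where d2: "d2 > 0" "\<And>Q. Q \<in> U \<Longrightarrow> dist Q P < d2 \<Longrightarrow> dist (f Q) (f P) < e"
    using smooth_on_imp_continuous_on[OF assms(1)] assms(2,3) unfolding continuous_on_iff by blast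
  show thesis
  proof (rule that[of "min d1 d2"])
    fix v assume "v \<in> V" "norm v < min d1 d2"
    then show "P + v \<in> U \<and> norm (f (P + v) - f P) \<le> e"
      using d1(2)[of v] d2(2)[of "P + v"] by (auto simp: dist_norm less_imp_le)
  qed (use d1(1) d2(1) in auto)
qed

text \<open>
  Directional derivatives that are merely known to exist need not be additive in the direction; continuity
  is what makes them so. Going from \<open>P\<close> to \<open>P + t(u + v)\<close> through \<open>P + tu\<close>, the second leg contributes
  \<open>t\<close> times the derivative along \<open>v\<close> at points near \<open>P\<close>, which is close to its value at \<open>P\<close>.
\<close>

lemma dirderiv_add_direction:
  assumes f: "smooth_on V U f" and uv: "u \<in> V" "v \<in> V" and P: "P \<in> U"
  shows "dirderiv f (u + v) P = dirderiv f u P + dirderiv f v P"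
proof (rule dirderiv_eqI)
  note du = smooth_on_imp_has_dirderiv[OF f uv(1) P]
  define r where "r t = f (P + t *\<^sub>R (u + v)) - f (P + t *\<^sub>R u)" for t :: real
  have "(r has_derivative (\<lambda>h. h *\<^sub>R dirderiv f v P)) (at 0)"
    unfolding has_derivative_at_alt
  proof (intro conjI allI impI)
    show "bounded_linear (\<lambda>h. h *\<^sub>R dirderiv f v P)"
      by (rule bounded_linear_scaleR_left)
    fix e :: real assume "e > 0"
    then obtain d where d: "d > 0" "\<And>w. w \<in> V \<Longrightarrow> norm w < d \<Longrightarrow>
        P + w \<in> U \<and> norm (dirderiv f v (P + w) - dirderiv f v P) \<le> e"
      using smooth_on_near[OF smooth_on_dirderiv[OF f uv(2)] P] by blast
    define m where "m = norm u + norm v + 1"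
    have m: "m > 0" unfolding m_def by (simp add: add_nonneg_pos)
    show "\<exists>d>0. \<forall>t. norm (t - 0) < d \<longrightarrow>
        norm (r t - r 0 - (t - 0) *\<^sub>R dirderiv f v P) \<le> e * norm (t - 0)"
    proof (intro exI conjI allI impI)
      show "d / m > 0" using d(1) m by simp
      fix t :: real assume t: "norm (t - 0) < d / m"
      have near: "t *\<^sub>R u + s *\<^sub>R v \<in> V \<and> norm (t *\<^sub>R u + s *\<^sub>R v) < d"
        if "s \<in> closed_segment 0 t" for s
      proof
        show "t *\<^sub>R u + s *\<^sub>R v \<in> V"
          using uv by (intro subspace_add subspace_scale subspace_V)
        have "\<bar>s\<bar> \<le> \<bar>t\<bar>" using that by (auto simp: closed_segment_eq_real_ivl split: if_splits)
        then have "norm (t *\<^sub>R u + s *\<^sub>R v) \<le> \<bar>t\<bar> * norm u + \<bar>t\<bar> * norm v"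
          by (intro order_trans[OF norm_triangle_ineq]) (auto intro!: mult_right_mono)
        also have "\<dots> \<le> \<bar>t\<bar> * m" unfolding m_def by (simp add: algebra_simps)
        also have "\<dots> < d" using t m by (simp add: field_simps)
        finally show "norm (t *\<^sub>R u + s *\<^sub>R v) < d" .
      qed
      have "norm (f (P + t *\<^sub>R u + t *\<^sub>R v) - f (P + t *\<^sub>R u + 0 *\<^sub>R v) - t *\<^sub>R dirderiv f v P) \<le> e * \<bar>t\<bar>"
      proof (rule mean_value_linearization_bound)
        fix s assume s: "s \<in> closed_segment 0 t"
        have sU: "P + t *\<^sub>R u + s *\<^sub>R v \<in> U"
          and b: "norm (dirderiv f v (P + t *\<^sub>R u + s *\<^sub>R v) - dirderiv f v P) \<le> e"
          using d(2)[of "t *\<^sub>R u + s *\<^sub>R v"] near[OF s] by (auto simp: add.assoc)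
        show "((\<lambda>s. f (P + t *\<^sub>R u + s *\<^sub>R v)) has_vector_derivative
            dirderiv f v (P + t *\<^sub>R u + s *\<^sub>R v)) (at s)"
          by (rule has_dirderiv_line[OF smooth_on_imp_has_dirderiv[OF f uv(2) sU]])
        show "norm (dirderiv f v (P + t *\<^sub>R u + s *\<^sub>R v) - dirderiv f v P) \<le> e" by (rule b)
      qed
      then show "norm (r t - r 0 - (t - 0) *\<^sub>R dirderiv f v P) \<le> e * norm (t - 0)"
        unfolding r_def by (simp add: scaleR_add_right add.assoc)
    qed
  qed
  then have "(r has_vector_derivative dirderiv f v P) (at 0)"
    unfolding has_vector_derivative_def .
  from has_vector_derivative_add[OF du this]
  show "has_dirderiv f (dirderiv f u P + dirderiv f v P) (u + v) P"
    unfolding r_def by simp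
qed

lemma dirderiv_zero_direction: "dirderiv f 0 P = 0"
  unfolding dirderiv_def by simp

lemma dirderiv_sum_direction:
  assumes f: "smooth_on V U f" and P: "P \<in> U" and "\<And>i. i \<in> I \<Longrightarrow> v i \<in> V"
  shows "dirderiv f (\<Sum>i\<in>I. c i *\<^sub>R v i) P = (\<Sum>i\<in>I. c i *\<^sub>R dirderiv f (v i) P)"
  using assms(3)
proof (induction I rule: infinite_finite_induct)
  case (insert i I)
  then show ?case
    using subspace_V
    by (simp add: dirderiv_add_direction[OF f _ _ P] dirderiv_scaleR[OF f _ P] subspace_scale subspace_sum)
qed (auto simp: dirderiv_zero_direction)

lemma dirderiv_diff_direction:
  assumes f: "smooth_on V U f" and uv: "u \<in> V" "v \<in> V" and P: "P \<in> U"
  shows "dirderiv f (u - v) P = dirderiv f u P - dirderiv f v P"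
  using dirderiv_add_direction[OF f _ uv(2) P, of "u - v"] uv subspace_diff[OF subspace_V] by simp

definition second_difference :: "('a \<Rightarrow> 'b::real_normed_vector) \<Rightarrow> 'a \<Rightarrow> 'a \<Rightarrow> 'a \<Rightarrow> 'b" where
  "second_difference f P u v = f (P + u + v) - f (P + u) - f (P + v) + f P"

lemma second_difference_commute: "second_difference f P u v = second_difference f P v u"
  unfolding second_difference_def by (simp add: add.assoc add.commute[of u])

text \<open>
  The second difference is \<open>t\<^sup>2\<close> times the mixed derivative up to the oscillation of the latter on the
  parallelogram: the mean value inequality is applied along \<open>v\<close> to the derivative along \<open>u\<close>, then along
  \<open>u\<close> to the function itself.
\<close>

lemma second_difference_bound:
  assumes f: "smooth_on V U f" and uv: "u \<in> V" "v \<in> V" and "t \<ge> 0"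
    and near: "\<And>r s. r \<in> {0..t} \<Longrightarrow> s \<in> {0..t} \<Longrightarrow> P + r *\<^sub>R u + s *\<^sub>R v \<in> U \<and>
      norm (dirderiv (dirderiv f u) v (P + r *\<^sub>R u + s *\<^sub>R v) - c) \<le> e"
  shows "norm (second_difference f P (t *\<^sub>R u) (t *\<^sub>R v) - t\<^sup>2 *\<^sub>R c) \<le> e * t\<^sup>2"
proof -
  have seg: "closed_segment 0 t = {0..t}" using \<open>t \<ge> 0\<close> by (simp add: closed_segment_eq_real_ivl)
  have inner_bound: "norm (dirderiv f u (P + t *\<^sub>R v + r *\<^sub>R u) - dirderiv f u (P + r *\<^sub>R u) - t *\<^sub>R c) \<le> e * t"
    if r: "r \<in> {0..t}" for r
  proof -
    have "norm (dirderiv f u (P + r *\<^sub>R u + t *\<^sub>R v) - dirderiv f u (P + r *\<^sub>R u + 0 *\<^sub>R v) - t *\<^sub>R c) \<le> e * \<bar>t\<bar>"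
    proof (rule mean_value_linearization_bound, unfold seg)
      fix s assume s: "s \<in> {0..t}"
      show "((\<lambda>s. dirderiv f u (P + r *\<^sub>R u + s *\<^sub>R v)) has_vector_derivative
          dirderiv (dirderiv f u) v (P + r *\<^sub>R u + s *\<^sub>R v)) (at s)"
        using near[OF r s]
        by (intro has_dirderiv_line[OF smooth_on_imp_has_dirderiv[OF smooth_on_dirderiv[OF f uv(1)] uv(2)]]) auto
    qed (use near[OF r] in auto)
    then show ?thesis using \<open>t \<ge> 0\<close> by (simp add: ac_simps)
  qed
  have "norm ((f (P + t *\<^sub>R v + t *\<^sub>R u) - f (P + t *\<^sub>R u)) - (f (P + t *\<^sub>R v + 0 *\<^sub>R u) - f (P + 0 *\<^sub>R u))
      - t *\<^sub>R (t *\<^sub>R c)) \<le> (e * t) * \<bar>t\<bar>"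
  proof (rule mean_value_linearization_bound, unfold seg)
    fix r assume r: "r \<in> {0..t}"
    have "P + r *\<^sub>R u \<in> U" "P + t *\<^sub>R v + r *\<^sub>R u \<in> U"
      using near[OF r, of 0] near[OF r, of t] \<open>t \<ge> 0\<close> by (auto simp: ac_simps)
    then show "((\<lambda>r. f (P + t *\<^sub>R v + r *\<^sub>R u) - f (P + r *\<^sub>R u)) has_vector_derivative
        dirderiv f u (P + t *\<^sub>R v + r *\<^sub>R u) - dirderiv f u (P + r *\<^sub>R u)) (at r)"
      by (intro has_vector_derivative_diff has_dirderiv_line[OF smooth_on_imp_has_dirderiv[OF f uv(1)]])
    show "norm (dirderiv f u (P + t *\<^sub>R v + r *\<^sub>R u) - dirderiv f u (P + r *\<^sub>R u) - t *\<^sub>R c) \<le> e * t"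
      by (rule inner_bound[OF r])
  qed
  moreover have "f (P + t *\<^sub>R v + t *\<^sub>R u) - f (P + t *\<^sub>R u) - (f (P + t *\<^sub>R v + 0 *\<^sub>R u) - f (P + 0 *\<^sub>R u))
      = second_difference f P (t *\<^sub>R u) (t *\<^sub>R v)"
    unfolding second_difference_commute[of f P "t *\<^sub>R u"] unfolding second_difference_def by simp
  moreover have "t *\<^sub>R (t *\<^sub>R c) = t\<^sup>2 *\<^sub>R c" "e * t * \<bar>t\<bar> = e * t\<^sup>2"
    using \<open>t \<ge> 0\<close> by (simp_all add: power2_eq_square)
  ultimately show ?thesis by (simp only:)
qed

text \<open>
  The second difference does not depend on the order of the two increments, so both mixed
  derivatives are the limit of the same quotient.
\<close>

lemma dirderiv_commute:
  assumes f: "smooth_on V U f" and uv: "u \<in> V" "v \<in> V" and P: "P \<in> U"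
  shows "dirderiv (dirderiv f u) v P = dirderiv (dirderiv f v) u P"
proof -
  let ?a = "dirderiv (dirderiv f u) v" and ?b = "dirderiv (dirderiv f v) u"
  have "norm (?a P - ?b P) \<le> 2 * e" if "e > 0" for e
  proof -
    have sa: "smooth_on V U ?a" and sb: "smooth_on V U ?b"
      using f uv by (auto intro: smooth_on_dirderiv)
    obtain d1 where d1: "d1 > 0" "\<And>w. w \<in> V \<Longrightarrow> norm w < d1 \<Longrightarrow> P + w \<in> U \<and> norm (?a (P + w) - ?a P) \<le> e"
      using smooth_on_near[OF sa P \<open>e > 0\<close>] by blast
    obtain d2 where d2: "d2 > 0" "\<And>w. w \<in> V \<Longrightarrow> norm w < d2 \<Longrightarrow> P + w \<in> U \<and> norm (?b (P + w) - ?b P) \<le> e"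
      using smooth_on_near[OF sb P \<open>e > 0\<close>] by blast
    define m where "m = norm u + norm v + 1"
    have m: "m > 0" unfolding m_def by (simp add: add_nonneg_pos)
    define t where "t = min d1 d2 / (2 * m)"
    have t: "t > 0" using d1(1) d2(1) m unfolding t_def by simp
    have small: "r *\<^sub>R u + s *\<^sub>R v \<in> V \<and> norm (r *\<^sub>R u + s *\<^sub>R v) < d1 \<and> norm (r *\<^sub>R u + s *\<^sub>R v) < d2"
      if "r \<in> {0..t}" "s \<in> {0..t}" for r s
    proof -
      have "norm (r *\<^sub>R u + s *\<^sub>R v) \<le> t * norm u + t * norm v"
        using that by (intro order_trans[OF norm_triangle_ineq]) (auto intro!: add_mono mult_right_mono)
      also have "\<dots> \<le> t * m" unfolding m_def using t by (simp add: algebra_simps)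
      also have "t * m = min d1 d2 / 2" using m unfolding t_def by simp
      also have "\<dots> < min d1 d2" using d1(1) d2(1) by (auto simp: min_def)
      finally show ?thesis
        using uv by (simp add: subspace_add subspace_scale subspace_V)
    qed
    have A: "norm (second_difference f P (t *\<^sub>R u) (t *\<^sub>R v) - t\<^sup>2 *\<^sub>R ?a P) \<le> e * t\<^sup>2"
      using d1(2) small t by (intro second_difference_bound f uv) (auto simp: add.assoc)
    have B: "norm (second_difference f P (t *\<^sub>R v) (t *\<^sub>R u) - t\<^sup>2 *\<^sub>R ?b P) \<le> e * t\<^sup>2"
    proof (intro second_difference_bound f uv)
      fix r s assume rs: "r \<in> {0..t}" "s \<in> {0..t}"
      have "P + r *\<^sub>R v + s *\<^sub>R u = P + (s *\<^sub>R u + r *\<^sub>R v)" by simp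
      then show "P + r *\<^sub>R v + s *\<^sub>R u \<in> U \<and> norm (?b (P + r *\<^sub>R v + s *\<^sub>R u) - ?b P) \<le> e"
        unfolding \<open>P + r *\<^sub>R v + s *\<^sub>R u = _\<close> using d2(2) small[OF rs(2,1)] by blast
    qed (use t in simp)
    have "t\<^sup>2 * norm (?a P - ?b P) = norm (t\<^sup>2 *\<^sub>R ?a P - t\<^sup>2 *\<^sub>R ?b P)"
      by (simp add: scaleR_diff_right[symmetric])
    also have "\<dots> = norm ((second_difference f P (t *\<^sub>R u) (t *\<^sub>R v) - t\<^sup>2 *\<^sub>R ?b P)
        - (second_difference f P (t *\<^sub>R u) (t *\<^sub>R v) - t\<^sup>2 *\<^sub>R ?a P))"
      by simp
    also have "\<dots> \<le> e * t\<^sup>2 + e * t\<^sup>2"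
      by (rule order_trans[OF norm_triangle_ineq4
            add_mono[OF B[unfolded second_difference_commute[of f P "t *\<^sub>R v"]] A]])
    also have "\<dots> = t\<^sup>2 * (2 * e)" by simp
    finally show ?thesis using t by simp
  qed
  from this[of "norm (?a P - ?b P) / 4"] show ?thesis by (cases "?a P = ?b P") auto
qed

lemma vector_fields_smooth: "X \<in> vector_fields V U \<Longrightarrow> smooth_on V U X"
  and vector_fields_in_V: "X \<in> vector_fields V U \<Longrightarrow> P \<in> U \<Longrightarrow> X P \<in> V"
  unfolding vector_fields_def by auto

text \<open>
  Difference quotients of a field with values in \<open>V\<close> lie in \<open>V\<close>, which is closed.
\<close>

lemma dirderiv_in_V:
  assumes X: "X \<in> vector_fields V U" and "v \<in> V" "P \<in> U"
  shows "dirderiv X v P \<in> V"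
proof -
  obtain S where S: "open S" "(0::real) \<in> S" "\<And>t. t \<in> S \<Longrightarrow> P + t *\<^sub>R v \<in> U"
    using line_near_in_U[OF assms(3,2)] by blast
  have "((\<lambda>t. (X (P + t *\<^sub>R v) - X P) /\<^sub>R t) \<longlongrightarrow> dirderiv X v P) (at 0)"
    using smooth_on_imp_has_dirderiv[OF vector_fields_smooth[OF X] assms(2,3)]
    by (simp add: has_vector_derivative_iff_quotient)
  moreover have "\<forall>\<^sub>F t in at 0. (X (P + t *\<^sub>R v) - X P) /\<^sub>R t \<in> V"
    using S
    by (intro eventually_at_topological[THEN iffD2] exI[of _ S])
       (auto intro!: subspace_scale subspace_diff subspace_V vector_fields_in_V[OF X] assms)
  ultimately show ?thesis
    using closed_subspace[OF subspace_V] by (intro Lim_in_closed_set) auto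
qed

text \<open>
  Stands in for an orthonormal basis of \<open>V\<close>, through the expansion formula that turns a moving direction into
  constant directions with smooth coefficients.
\<close>

definition frame :: "'a set \<Rightarrow> bool" where
  "frame B \<longleftrightarrow> B \<subseteq> V \<and> (\<forall>x\<in>V. (\<Sum>b\<in>B. (x \<bullet> b) *\<^sub>R b) = x)"

lemma ex_frame: "\<exists>B. frame B"
proof -
  obtain B where B: "B \<subseteq> V" "pairwise orthogonal B" "\<And>x. x \<in> B \<Longrightarrow> norm x = 1"
    "independent B" "card B = dim V" "span B = V"
    by (rule orthonormal_basis_subspace[OF subspace_V]) blast
  have "(\<Sum>b\<in>B. (x \<bullet> b) *\<^sub>R b) = x" if "x \<in> V" for x
    using that B independent_imp_finite[OF B(4)] by (intro orthonormal_basis_expand) auto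
  then have "frame B" using B(1) by (simp add: frame_def)
  then show ?thesis ..
qed

lemma dirderiv_frame:
  assumes B: "frame B" and f: "smooth_on V U f" and x: "x \<in> V" and P: "P \<in> U"
  shows "dirderiv f x P = (\<Sum>b\<in>B. (x \<bullet> b) *\<^sub>R dirderiv f b P)"
proof -
  have "dirderiv f x P = dirderiv f (\<Sum>b\<in>B. (x \<bullet> b) *\<^sub>R b) P"
    using B x by (simp add: frame_def)
  also have "\<dots> = (\<Sum>b\<in>B. (x \<bullet> b) *\<^sub>R dirderiv f b P)"
    using B by (intro dirderiv_sum_direction f P) (auto simp: frame_def)
  finally show ?thesis .
qed

text \<open>
  In the definition of \<open>Ck_on\<close> the directions are constant. A frame reduces differentiation along a vector
  field to that case.
\<close>

lemma smooth_on_dirderiv_along_field: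
  assumes X: "X \<in> vector_fields V U" and f: "smooth_on V U f"
  shows "smooth_on V U (\<lambda>P. dirderiv f (X P) P)"
proof -
  obtain B where B: "frame B" using ex_frame by blast
  have "smooth_on V U (\<lambda>P. \<Sum>b\<in>B. (X P \<bullet> b) *\<^sub>R dirderiv f b P)"
    using B by (intro smooth_on_sum smooth_on_bounded_bilinear[OF bounded_bilinear_scaleR]
        smooth_on_bounded_linear[OF bounded_linear_inner_left] vector_fields_smooth[OF X]
        smooth_on_dirderiv[OF f]) (auto simp: frame_def)
  then show ?thesis
    by (rule smooth_on_cong[rotated]) (simp add: dirderiv_frame[OF B f vector_fields_in_V[OF X]])
qed

text \<open>
  The direction \<open>X Q\<close> moves with the point: its own derivative gives the first term. The
  second term is the second derivative of \<open>f\<close>, with the directions exchanged by symmetry.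
\<close>

lemma dirderiv_along_field:
  assumes X: "X \<in> vector_fields V U" and f: "smooth_on V U f" and u: "u \<in> V" and P: "P \<in> U"
  shows "dirderiv (\<lambda>Q. dirderiv f (X Q) Q) u P =
    dirderiv f (dirderiv X u P) P + dirderiv (dirderiv f u) (X P) P"
proof -
  obtain B where B: "frame B" using ex_frame by blast
  note X' = vector_fields_smooth[OF X]
  have coord: "smooth_on V U (\<lambda>Q. X Q \<bullet> b)" for b
    by (rule smooth_on_bounded_linear[OF bounded_linear_inner_left X'])
  have "dirderiv (\<lambda>Q. dirderiv f (X Q) Q) u P = dirderiv (\<lambda>Q. \<Sum>b\<in>B. (X Q \<bullet> b) *\<^sub>R dirderiv f b Q) u P"
    by (rule dirderiv_cong[OF P u]) (rule dirderiv_frame[OF B f vector_fields_in_V[OF X]])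
  also have "\<dots> = (\<Sum>b\<in>B. dirderiv (\<lambda>Q. (X Q \<bullet> b) *\<^sub>R dirderiv f b Q) u P)"
    using B by (intro dirderiv_sum u P smooth_on_bounded_bilinear[OF bounded_bilinear_scaleR]
        coord smooth_on_dirderiv[OF f]) (auto simp: frame_def)
  also have "\<dots> = (\<Sum>b\<in>B. (X P \<bullet> b) *\<^sub>R dirderiv (dirderiv f u) b P
      + (dirderiv X u P \<bullet> b) *\<^sub>R dirderiv f b P)"
  proof (rule sum.cong)
    fix b assume "b \<in> B"
    then have b: "b \<in> V" using B by (auto simp: frame_def)
    show "dirderiv (\<lambda>Q. (X Q \<bullet> b) *\<^sub>R dirderiv f b Q) u P =
        (X P \<bullet> b) *\<^sub>R dirderiv (dirderiv f u) b P + (dirderiv X u P \<bullet> b) *\<^sub>R dirderiv f b P"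
      unfolding dirderiv_bounded_bilinear[OF bounded_bilinear_scaleR coord smooth_on_dirderiv[OF f b] u P]
        dirderiv_bounded_linear[OF bounded_linear_inner_left X' u P] dirderiv_commute[OF f b u P] ..
  qed simp
  also have "\<dots> = dirderiv (dirderiv f u) (X P) P + dirderiv f (dirderiv X u P) P"
    by (simp add: sum.distrib dirderiv_frame[OF B f dirderiv_in_V[OF X u P] P]
        dirderiv_frame[OF B smooth_on_dirderiv[OF f u] vector_fields_in_V[OF X P] P])
  finally show ?thesis by simp
qed

end

section \<open>Uniqueness of the Levi-Civita connection\<close>

context linear_domain begin

lemma is_levi_civita_fields:
  assumes "is_levi_civita V U g D" "X \<in> vector_fields V U" "Y \<in> vector_fields V U"
  shows "D X Y \<in> vector_fields V U"
  using assms(1)[unfolded is_levi_civita_def affine_connection_def, THEN conjunct1, THEN conjunct1] assms(2,3)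
  by blast

lemma is_levi_civita_torsion_free:
  assumes "is_levi_civita V U g D" "X \<in> vector_fields V U" "Y \<in> vector_fields V U" "P \<in> U"
  shows "D X Y P - D Y X P = lie_bracket X Y P"
  using assms(1)[unfolded is_levi_civita_def, THEN conjunct2, THEN conjunct1] assms(2-4)
  by blast

lemma is_levi_civita_metric:
  assumes "is_levi_civita V U g D"
    "X \<in> vector_fields V U" "Y \<in> vector_fields V U" "Z \<in> vector_fields V U" "P \<in> U"
  shows "dirderiv (\<lambda>Q. g Q (Y Q) (Z Q)) (X P) P = g P (D X Y P) (Z P) + g P (Y P) (D X Z P)"
  using assms(1)[unfolded is_levi_civita_def, THEN conjunct2, THEN conjunct2] assms(2-5)
  by blast

text \<open>
  The difference \<open>S\<close> of two such connections is symmetric because both are torsion free, and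
  \<open>g (S A B) C\<close> is antisymmetric in \<open>B\<close>, \<open>C\<close> because both are metric. A trilinear form that is symmetric
  in the first two and antisymmetric in the last two arguments vanishes; the field \<open>C\<close> is taken to be the
  constant value of \<open>S\<close> at the point.
\<close>

lemma levi_civita_unique:
  assumes g: "riemannian_manifold V U g"
    and D: "is_levi_civita V U g D" and D': "is_levi_civita V U g D'"
    and X: "X \<in> vector_fields V U" and Y: "Y \<in> vector_fields V U" and P: "P \<in> U"
  shows "D X Y P = D' X Y P"
proof -
  note at_P = g[unfolded riemannian_manifold_def, THEN conjunct2, THEN conjunct2, THEN conjunct1, THEN bspec, OF P]
  have g_add: "g P (x + y) z = g P x z + g P y z" if "x \<in> V" "y \<in> V" "z \<in> V" for x y z
    using at_P[THEN conjunct1] that by blast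
  have g_sym: "g P x y = g P y x" if "x \<in> V" "y \<in> V" for x y
    using at_P[THEN conjunct2, THEN conjunct2, THEN conjunct1] that by blast
  have g_pos: "g P x x > 0" if "x \<in> V" "x \<noteq> 0" for x
    using at_P[THEN conjunct2, THEN conjunct2, THEN conjunct2] that by blast
  have g_diff: "g P (x - y) z = g P x z - g P y z" if "x \<in> V" "y \<in> V" "z \<in> V" for x y z
    using g_add[of "x - y" y z] that subspace_diff[OF subspace_V] by simp
  have DV: "D A B P \<in> V" "D' A B P \<in> V"
    if "A \<in> vector_fields V U" "B \<in> vector_fields V U" for A B
    using is_levi_civita_fields[OF D that] is_levi_civita_fields[OF D' that] P
    by (auto intro: vector_fields_in_V)
  define S where "S A B = D A B P - D' A B P" for A B
  have SV: "S A B \<in> V" if "A \<in> vector_fields V U" "B \<in> vector_fields V U" for A B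
    unfolding S_def using that by (intro subspace_diff subspace_V DV)
  have sym: "S A B = S B A" if "A \<in> vector_fields V U" "B \<in> vector_fields V U" for A B
  proof -
    have "S A B - S B A = (D A B P - D B A P) - (D' A B P - D' B A P)"
      unfolding S_def by simp
    also have "\<dots> = 0"
      unfolding is_levi_civita_torsion_free[OF D that P] is_levi_civita_torsion_free[OF D' that P] by simp
    finally show ?thesis by simp
  qed
  have skew: "g P (S A B) (C P) = - g P (S A C) (B P)"
    if A: "A \<in> vector_fields V U" and B: "B \<in> vector_fields V U" and C: "C \<in> vector_fields V U" for A B C
  proof -
    have "g P (D A B P) (C P) + g P (B P) (D A C P) = g P (D' A B P) (C P) + g P (B P) (D' A C P)"
      using is_levi_civita_metric[OF D A B C P] is_levi_civita_metric[OF D' A B C P] by simp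
    moreover have "g P (S A B) (C P) = g P (D A B P) (C P) - g P (D' A B P) (C P)"
      unfolding S_def using A B C P by (intro g_diff DV vector_fields_in_V)
    moreover have "g P (S A C) (B P) = g P (D A C P) (B P) - g P (D' A C P) (B P)"
      unfolding S_def using A B C P by (intro g_diff DV vector_fields_in_V)
    moreover have "g P (D A C P) (B P) = g P (B P) (D A C P)" "g P (D' A C P) (B P) = g P (B P) (D' A C P)"
      by (simp_all add: g_sym[OF _ vector_fields_in_V[OF B P]] DV[OF A C])
    ultimately show ?thesis by simp
  qed
  define Z where "Z = (\<lambda>Q::'a. S X Y)"
  have Z: "Z \<in> vector_fields V U"
    unfolding Z_def vector_fields_def using SV[OF X Y] by (simp add: smooth_on_const)
  have "g P (S X Y) (Z P) = - g P (S X Z) (Y P)" by (rule skew[OF X Y Z])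
  also have "\<dots> = g P (S Z Y) (X P)" using skew[OF Z X Y] sym[OF X Z] by simp
  also have "\<dots> = - g P (S X Y) (Z P)" using skew[OF Y Z X] sym[OF Y Z] sym[OF X Y] by simp
  finally have "g P (S X Y) (S X Y) = 0" unfolding Z_def by simp
  then have "S X Y = 0" using g_pos[OF SV[OF X Y]] by fastforce
  then show ?thesis unfolding S_def by simp
qed

text \<open>
  The curvature is defined through a chosen Levi-Civita connection, which may differ from \<open>D\<close> outside of \<open>U\<close>.
  Since \<open>D\<close> differentiates only values on \<open>U\<close>, the two agree also after being applied twice.
\<close>

lemma riemann_curvature_eq:
  assumes g: "riemannian_manifold V U g" and D: "is_levi_civita V U g D"
    and D_local: "\<And>A F G P. A \<in> vector_fields V U \<Longrightarrow> P \<in> U \<Longrightarrow> (\<And>Q. Q \<in> U \<Longrightarrow> F Q = G Q) \<Longrightarrow> D A F P = D A G P"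
    and X: "X \<in> vector_fields V U" and Y: "Y \<in> vector_fields V U" and Z: "Z \<in> vector_fields V U"
    and P: "P \<in> U"
  shows "riemann_curvature V U g X Y Z P = D X (D Y Z) P - D Y (D X Z) P - D (lie_bracket X Y) Z P"
proof -
  define E where "E = levi_civita V U g"
  have E: "is_levi_civita V U g E"
    unfolding E_def levi_civita_def by (rule someI[of "is_levi_civita V U g", OF D])
  have E_fields: "E A B \<in> vector_fields V U" if "A \<in> vector_fields V U" "B \<in> vector_fields V U" for A B
    using E that by (rule is_levi_civita_fields)
  have ED: "E A B Q = D A B Q" if "A \<in> vector_fields V U" "B \<in> vector_fields V U" "Q \<in> U" for A B Q
    by (rule levi_civita_unique[OF g E D that])
  have second: "E A (E B Z) P = D A (D B Z) P"
    if "A \<in> vector_fields V U" "B \<in> vector_fields V U" for A B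
  proof -
    have "E A (E B Z) P = D A (E B Z) P" by (rule ED[OF that(1) E_fields[OF that(2) Z] P])
    also have "\<dots> = D A (D B Z) P" by (rule D_local[OF that(1) P]) (rule ED[OF that(2) Z])
    finally show ?thesis .
  qed
  have bracket: "lie_bracket X Y \<in> vector_fields V U"
  proof -
    have "smooth_on V U (lie_bracket X Y)"
      unfolding lie_bracket_def[abs_def] using X Y
      by (intro smooth_on_diff smooth_on_dirderiv_along_field vector_fields_smooth)
    moreover have "lie_bracket X Y Q \<in> V" if "Q \<in> U" for Q
      unfolding lie_bracket_def using X Y that
      by (intro subspace_diff subspace_V dirderiv_in_V vector_fields_in_V)
    ultimately show ?thesis unfolding vector_fields_def by simp
  qed
  show ?thesis
    unfolding riemann_curvature_def Let_def E_def[symmetric]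
    by (simp add: second X Y ED[OF bracket Z P])
qed

end

section \<open>Real Hilbert algebras and their cone of positive definite elements\<close>

text \<open>
  The minimum \<open>l\<close> of the Rayleigh quotient is attained on the compact unit sphere, at \<open>w\<close> say. The form
  \<open>x \<bullet> (T x - l x)\<close> is then nonnegative and vanishes at \<open>w\<close>. Its first variation at \<open>w\<close> in the
  direction \<open>z = T w - l w\<close> is \<open>2 (z \<bullet> z)\<close>, so \<open>z = 0\<close>.
\<close>

lemma self_adjoint_min_eigenvector:
  fixes T :: "'a::euclidean_space \<Rightarrow> 'a"
  assumes lin: "linear T" and self_adjoint: "\<And>x y. T x \<bullet> y = x \<bullet> T y"
  shows "\<exists>l w. w \<noteq> 0 \<and> T w = l *\<^sub>R w \<and> (\<forall>x. l * (x \<bullet> x) \<le> x \<bullet> T x)"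
proof -
  have cont: "continuous_on (sphere 0 1) (\<lambda>x. x \<bullet> T x)"
    using linear_continuous_on[OF linear_conv_bounded_linear[THEN iffD1, OF lin]]
    by (intro continuous_intros)
  have "sphere (0::'a) 1 \<noteq> {}" by simp
  then obtain w where w: "norm w = 1" "\<And>x. norm x = 1 \<Longrightarrow> w \<bullet> T w \<le> x \<bullet> T x"
    using continuous_attains_inf[OF compact_sphere _ cont] by auto
  define l where "l = w \<bullet> T w"
  have bound: "l * (x \<bullet> x) \<le> x \<bullet> T x" for x
  proof (cases "x = 0")
    case False
    then have "l \<le> (x /\<^sub>R norm x) \<bullet> T (x /\<^sub>R norm x)"
      unfolding l_def by (intro w(2)) simp
    then show ?thesis
      using False by (simp add: linear_cmul[OF lin] field_simps power2_norm_eq_inner[symmetric] power2_eq_square)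
  qed (simp add: linear_0[OF lin])
  define z where "z = T w - l *\<^sub>R w"
  have ww: "w \<bullet> w = 1" using w(1) by (simp add: norm_eq_1)
  have "z = 0"
  proof (rule ccontr)
    assume "z \<noteq> 0"
    define a where "a = z \<bullet> z"
    define k where "k = z \<bullet> T z - l * (z \<bullet> z)"
    \<comment> \<open>small enough for the linear term \<open>2 t a\<close> to outweigh the quadratic term \<open>t\<^sup>2 k\<close>\<close>
    define t where "t = a / (k + 1)"
    have a: "a > 0" using \<open>z \<noteq> 0\<close> by (simp add: a_def)
    have k: "k \<ge> 0" using bound[of z] by (simp add: k_def)
    have wz: "w \<bullet> T z - l * (w \<bullet> z) = a"
      unfolding self_adjoint[symmetric] a_def by (simp add: z_def inner_diff_left)
    have "0 \<le> (w - t *\<^sub>R z) \<bullet> T (w - t *\<^sub>R z) - l * ((w - t *\<^sub>R z) \<bullet> (w - t *\<^sub>R z))"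
      using bound[of "w - t *\<^sub>R z"] by simp
    also have "\<dots> = (w \<bullet> T w - l * (w \<bullet> w)) - 2 * t * (w \<bullet> T z - l * (w \<bullet> z)) + t\<^sup>2 * k"
      using self_adjoint[of w z] inner_commute[of z w] inner_commute[of z "T w"]
      unfolding k_def linear_diff[OF lin] linear_cmul[OF lin] power2_eq_square
      by (simp add: inner_diff_left inner_diff_right algebra_simps)
    also have "\<dots> = t\<^sup>2 * k - 2 * t * a" unfolding wz by (simp add: l_def ww)
    also have "\<dots> = t * (t * k - 2 * a)" by (simp add: power2_eq_square algebra_simps)
    finally have "0 \<le> t * (t * k - 2 * a)" .
    moreover have "t > 0" using a k by (simp add: t_def)
    moreover have "t * k \<le> a" using a k by (simp add: t_def field_simps)
    ultimately show False using a by (simp add: zero_le_mult_iff)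
  qed
  then have "T w = l *\<^sub>R w" by (simp add: z_def)
  moreover have "w \<noteq> 0" using w(1) by auto
  ultimately show ?thesis using bound by blast
qed

text \<open>
  These are the finite-dimensional real \<open>H\<^sup>*\<close>-algebras with unit: left and right multiplication by
  \<open>x\<close> have multiplication by \<open>star x\<close> as their adjoint. Square matrices with the Frobenius inner product are
  the standard example. The properties of \<open>star\<close> as an involution and of the trace \<open>x \<mapsto> one \<bullet> x\<close> follow.
  The factor \<open>c\<close> scales the metric; for tensors of depth \<open>p\<close>, the real part of the trace is \<open>p\<close> times \<open>one \<bullet> x\<close>.
\<close>

locale hilbert_algebra =
  fixes mult :: "'a::euclidean_space \<Rightarrow> 'a \<Rightarrow> 'a"  (infixl \<open>\<cdot>\<close> 70)
    and one :: 'a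
    and star :: "'a \<Rightarrow> 'a"
    and c :: real
  assumes bounded_bilinear_mult: "bounded_bilinear (\<cdot>)"
    and mult_assoc: "x \<cdot> y \<cdot> z = x \<cdot> (y \<cdot> z)"
    and mult_one_left: "one \<cdot> x = x"
    and mult_one_right: "x \<cdot> one = x"
    and inner_mult_left: "(x \<cdot> y) \<bullet> z = y \<bullet> (star x \<cdot> z)"
    and inner_mult_right: "(y \<cdot> x) \<bullet> z = y \<bullet> (z \<cdot> star x)"
    and c_pos: "c > 0"
begin

sublocale mult: bounded_bilinear "(\<cdot>)"
  by (rule bounded_bilinear_mult)

lemma star_star: "star (star x) = x"
proof -
  have "(star (star x) \<cdot> one) \<bullet> z = (x \<cdot> one) \<bullet> z" for z
    by (metis inner_commute inner_mult_left)
  then have "star (star x) \<bullet> z = x \<bullet> z" for z by (simp add: mult_one_right)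
  then show ?thesis using vector_eq_rdot by blast
qed

text \<open>
  Adjoints are unique.
\<close>

lemma star_eqI:
  assumes "\<And>y z. (x \<cdot> y) \<bullet> z = y \<bullet> (w \<cdot> z)"
  shows "star x = w"
proof -
  have "y \<bullet> star x = y \<bullet> w" for y
    using assms[of y one] inner_mult_left[of x y one] by (simp add: mult_one_right)
  then show ?thesis using vector_eq_ldot by blast
qed

lemma star_mult: "star (x \<cdot> y) = star y \<cdot> star x"
  by (rule star_eqI) (simp add: mult_assoc inner_mult_left)

lemma star_add: "star (x + y) = star x + star y"
  by (rule star_eqI) (simp add: mult.add_left inner_add_left inner_add_right inner_mult_left)

lemma star_scaleR: "star (r *\<^sub>R x) = r *\<^sub>R star x"
  by (rule star_eqI) (simp add: mult.scaleR_left inner_mult_left)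

lemma star_diff: "star (x - y) = star x - star y"
  by (rule star_eqI) (simp add: mult.diff_left inner_diff_left inner_diff_right inner_mult_left)

lemma star_one: "star one = one"
  by (rule star_eqI) (simp add: mult_one_left)

lemma inner_star: "star x \<bullet> star y = x \<bullet> y"
proof -
  have "star x \<bullet> star y = one \<bullet> (star y \<cdot> x)"
    using inner_mult_right[of one "star x" "star y"] by (simp add: mult_one_left star_star)
  also have "\<dots> = y \<bullet> x"
    using inner_mult_left[of y one x] by (simp add: mult_one_right)
  finally show ?thesis by (simp add: inner_commute)
qed

definition tr :: "'a \<Rightarrow> real" where "tr x = one \<bullet> x"

lemma inner_eq_tr: "x \<bullet> y = tr (star x \<cdot> y)"
  unfolding tr_def using inner_mult_left[of x one y] by (simp add: mult_one_right)

lemma tr_commute: "tr (x \<cdot> y) = tr (y \<cdot> x)"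
  using inner_eq_tr[of "star x" y] inner_mult_right[of one "star x" y]
  unfolding tr_def by (simp add: star_star mult_one_left)

lemma tr_add: "tr (x + y) = tr x + tr y"
  and tr_diff: "tr (x - y) = tr x - tr y"
  and tr_minus: "tr (- x) = - tr x"
  and tr_scaleR: "tr (r *\<^sub>R x) = r * tr x"
  unfolding tr_def by (simp_all add: inner_add_right inner_diff_right)

definition hermitian :: "'a set" where "hermitian = {x. star x = x}"

definition posdef :: "'a set" where
  "posdef = {P \<in> hermitian. \<forall>w. w \<noteq> 0 \<longrightarrow> w \<bullet> (P \<cdot> w) > 0}"

definition ainv :: "'a \<Rightarrow> 'a" where
  "ainv x = (SOME y. x \<cdot> y = one \<and> y \<cdot> x = one)"

definition metric :: "'a \<Rightarrow> 'a \<Rightarrow> 'a \<Rightarrow> real" where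
  "metric P x y = c * tr (ainv P \<cdot> x \<cdot> ainv P \<cdot> y)"

lemma posdef_pos: "P \<in> posdef \<Longrightarrow> w \<noteq> 0 \<Longrightarrow> w \<bullet> (P \<cdot> w) > 0"
  and posdef_star: "P \<in> posdef \<Longrightarrow> star P = P"
  unfolding posdef_def hermitian_def by auto

lemma subspace_hermitian: "subspace hermitian"
  using star_scaleR[of 0 one]
  unfolding subspace_def hermitian_def by (auto simp: star_add star_scaleR)

text \<open>
  Left multiplication by a positive definite element is injective, hence surjective by
  finite dimension; this gives a right inverse, and injectivity makes it two-sided.
\<close>

lemma posdef_ainv:
  assumes P: "P \<in> posdef"
  shows "P \<cdot> ainv P = one" "ainv P \<cdot> P = one"
proof -
  have lin: "linear ((\<cdot>) P)"
    using mult.bounded_linear_right bounded_linear.linear by blast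
  have inj: "x = 0" if "P \<cdot> x = 0" for x
    using posdef_pos[OF P, of x] that by auto
  then have "inj ((\<cdot>) P)"
    using linear_injective_0[OF lin] by blast
  then have "surj ((\<cdot>) P)" by (rule linear_injective_imp_surjective[OF lin]) simp
  then obtain y where y: "P \<cdot> y = one" by (metis surjD)
  have "P \<cdot> (y \<cdot> P - one) = 0"
    by (simp add: mult.diff_right mult_one_right mult_one_left mult_assoc[symmetric] y)
  then have "y \<cdot> P = one" using inj by fastforce
  then have "P \<cdot> ainv P = one \<and> ainv P \<cdot> P = one"
    unfolding ainv_def using y someI[of "\<lambda>y. P \<cdot> y = one \<and> y \<cdot> P = one"] by blast
  then show "P \<cdot> ainv P = one" "ainv P \<cdot> P = one" by auto
qed

lemma ainv_unique:
  assumes P: "P \<in> posdef" and "P \<cdot> y = one"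
  shows "ainv P = y"
  by (metis assms(2) mult_assoc mult_one_left mult_one_right posdef_ainv(2)[OF P])

lemma ainv_in_posdef:
  assumes P: "P \<in> posdef"
  shows "ainv P \<in> posdef"
proof -
  have "P \<cdot> star (ainv P) = one"
    using arg_cong[OF posdef_ainv(2)[OF P], of star] by (simp add: star_mult posdef_star[OF P] star_one)
  then have herm: "star (ainv P) = ainv P" by (rule ainv_unique[OF P, symmetric])
  have "w \<bullet> (ainv P \<cdot> w) > 0" if "w \<noteq> 0" for w
  proof -
    define z where "z = ainv P \<cdot> w"
    have w: "w = P \<cdot> z" unfolding z_def by (simp add: mult_assoc[symmetric] posdef_ainv[OF P] mult_one_left)
    with that have "z \<noteq> 0" by (auto simp: mult.zero_right)
    then have "z \<bullet> (P \<cdot> z) > 0" by (rule posdef_pos[OF P])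
    then show ?thesis unfolding w[symmetric] by (simp add: z_def inner_commute)
  qed
  with herm show ?thesis unfolding posdef_def hermitian_def by blast
qed

text \<open>
  This inequality carries the whole result: it makes the metric positive definite and the curvature
  nonpositive. The usual proof takes a square root of \<open>B\<close>. Instead, let \<open>l\<close> be the least eigenvalue of
  \<open>w \<mapsto> B \<cdot> w \<cdot> B\<close>, with eigenvector \<open>v\<close>. Multiplying \<open>B \<cdot> v \<cdot> B = l v\<close> by the inverse of \<open>B\<close> on the right gives
  \<open>B \<cdot> v = l (v \<cdot> ainv B)\<close>. The inner products of \<open>v\<close> with \<open>B \<cdot> v\<close> and with \<open>v \<cdot> ainv B\<close> are both
  positive, hence so is \<open>l\<close>.
\<close>

lemma sandwich_pos:
  assumes B: "B \<in> posdef" and "w \<noteq> 0"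
  shows "tr (B \<cdot> star w \<cdot> B \<cdot> w) > 0"
proof -
  define T where "T x = B \<cdot> x \<cdot> B" for x
  have "bounded_linear T"
    unfolding T_def
    by (rule bounded_linear_compose[OF mult.bounded_linear_left mult.bounded_linear_right])
  then have lin: "linear T" by (rule bounded_linear.linear)
  have adj: "T x \<bullet> y = x \<bullet> T y" for x y
    unfolding T_def inner_mult_right[of "B \<cdot> x"] inner_mult_left[of B x] posdef_star[OF B]
    by (simp only: mult_assoc)
  obtain l v where v: "v \<noteq> 0" "T v = l *\<^sub>R v" and bound: "\<And>x. l * (x \<bullet> x) \<le> x \<bullet> T x"
    using self_adjoint_min_eigenvector[OF lin adj] by blast
  have Bv: "B \<cdot> v = l *\<^sub>R (v \<cdot> ainv B)"
  proof -
    have "T v \<cdot> ainv B = B \<cdot> v"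
      unfolding T_def by (simp add: mult_assoc posdef_ainv[OF B] mult_one_right)
    then show ?thesis by (simp add: v(2) mult.scaleR_left)
  qed
  have "v \<bullet> (v \<cdot> ainv B) = star v \<bullet> (ainv B \<cdot> star v)"
    using inner_star[of v "v \<cdot> ainv B"] posdef_star[OF ainv_in_posdef[OF B]] by (simp add: star_mult)
  moreover have "star v \<noteq> 0" using v(1) inner_star[of v v] by auto
  ultimately have "v \<bullet> (v \<cdot> ainv B) > 0" using posdef_pos[OF ainv_in_posdef[OF B]] by simp
  moreover have "l * (v \<bullet> (v \<cdot> ainv B)) > 0"
    using posdef_pos[OF B v(1)] by (simp add: Bv)
  ultimately have "l > 0" by (simp add: zero_less_mult_iff)
  then have "0 < l * (w \<bullet> w)" using \<open>w \<noteq> 0\<close> by simp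
  also have "\<dots> \<le> w \<bullet> T w" by (rule bound)
  also have "\<dots> = tr (B \<cdot> star w \<cdot> B \<cdot> w)"
    using tr_commute[of "star w \<cdot> B \<cdot> w" B] unfolding inner_eq_tr T_def by (simp add: mult_assoc)
  finally show ?thesis .
qed

text \<open>
  The least eigenvalue \<open>l\<close> of left multiplication by \<open>P\<close> is positive, and perturbing \<open>P\<close> by less than
  \<open>l / K\<close> changes the quadratic form by less than \<open>l\<close> on unit vectors.
\<close>

lemma openin_posdef: "openin (top_of_set hermitian) posdef"
  unfolding openin_euclidean_subtopology_iff
proof (intro conjI ballI)
  show "posdef \<subseteq> hermitian" unfolding posdef_def by blast
  fix P assume P: "P \<in> posdef"
  have lin: "linear ((\<cdot>) P)"
    using mult.bounded_linear_right bounded_linear.linear by blast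
  have "(P \<cdot> x) \<bullet> y = x \<bullet> (P \<cdot> y)" for x y
    by (simp add: inner_mult_left posdef_star[OF P])
  then obtain l v where v: "v \<noteq> 0" "P \<cdot> v = l *\<^sub>R v" and bound: "\<And>x. l * (x \<bullet> x) \<le> x \<bullet> (P \<cdot> x)"
    using self_adjoint_min_eigenvector[OF lin] by blast
  have "l * (v \<bullet> v) > 0" using posdef_pos[OF P v(1)] v(2) by simp
  then have l: "l > 0" by (rule zero_less_mult_pos2) (simp add: v(1))
  obtain K where K: "K > 0" "\<And>x y. norm (x \<cdot> y) \<le> norm x * norm y * K"
    using mult.pos_bounded by blast
  show "\<exists>e>0. \<forall>Q\<in>hermitian. dist Q P < e \<longrightarrow> Q \<in> posdef"
  proof (intro exI conjI ballI impI)
    show "l / K > 0" using l K(1) by simp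
    fix Q assume Q: "Q \<in> hermitian" and d: "dist Q P < l / K"
    have "w \<bullet> (Q \<cdot> w) > 0" if "w \<noteq> 0" for w
    proof -
      have "w \<bullet> ((P - Q) \<cdot> w) \<le> norm w * norm ((P - Q) \<cdot> w)"
        by (rule norm_cauchy_schwarz)
      also have "\<dots> \<le> norm w * (norm (P - Q) * norm w * K)"
        by (intro mult_left_mono K(2)) simp
      also have "\<dots> = (norm (P - Q) * K) * (w \<bullet> w)"
        by (simp add: power2_norm_eq_inner[symmetric] power2_eq_square)
      also have "\<dots> < l * (w \<bullet> w)"
        using d K(1) that by (intro mult_strict_right_mono) (auto simp: dist_norm norm_minus_commute field_simps)
      also have "\<dots> \<le> w \<bullet> (P \<cdot> w)" by (rule bound)
      finally show ?thesis by (simp add: mult.diff_left inner_diff_right)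
    qed
    then show "Q \<in> posdef" using Q unfolding posdef_def by blast
  qed
qed

sublocale linear_domain hermitian posdef
  using subspace_hermitian openin_posdef by unfold_locales

text \<open>
  The resolvent identity.
\<close>

lemma ainv_diff:
  assumes "P \<in> posdef" "Q \<in> posdef"
  shows "ainv Q - ainv P = - (ainv Q \<cdot> (Q - P) \<cdot> ainv P)"
  by (simp add: mult.diff_left mult.diff_right mult_assoc posdef_ainv[OF assms(1)] mult_one_right)
     (simp add: mult_assoc[symmetric] posdef_ainv[OF assms(2)] mult_one_left)

text \<open>
  For \<open>Q\<close> close to \<open>P\<close>, the resolvent identity first bounds the norm of \<open>ainv Q\<close> by \<open>2 b\<close>, where
  \<open>b\<close> exceeds the norm of \<open>ainv P\<close>, and then bounds the difference of the inverses by a multiple of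
  the distance. The two bounds on the radius \<open>d\<close> serve these two steps.
\<close>

lemma continuous_on_ainv: "continuous_on posdef ainv"
proof -
  obtain K where K: "K > 0" "\<And>x y. norm (x \<cdot> y) \<le> norm x * norm y * K"
    using mult.pos_bounded by blast
  have "\<exists>d>0. \<forall>Q\<in>posdef. dist Q P < d \<longrightarrow> dist (ainv Q) (ainv P) < e"
    if P: "P \<in> posdef" and e: "e > 0" for P e
  proof -
    define b where "b = norm (ainv P) + 1"
    have b: "b > 0" unfolding b_def by (simp add: add_nonneg_pos)
    define d where "d = min (1 / (2 * b * K\<^sup>2)) (e / (2 * b * b * K\<^sup>2))"
    have d: "d > 0" using b K(1) e by (simp add: d_def)
    have "dist (ainv Q) (ainv P) < e" if Q: "Q \<in> posdef" and dQ: "dist Q P < d" for Q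
    proof -
      define q where "q = norm (ainv Q)"
      define r where "r = norm (Q - P)"
      have r: "r \<ge> 0" "r < 1 / (2 * b * K\<^sup>2)" "r < e / (2 * b * b * K\<^sup>2)"
        using dQ by (auto simp: r_def d_def dist_norm)
      have "norm (ainv Q - ainv P) \<le> norm (ainv Q \<cdot> (Q - P)) * norm (ainv P) * K"
        unfolding ainv_diff[OF P Q] norm_minus_cancel by (rule K(2))
      also have "\<dots> \<le> (q * r * K) * b * K"
        unfolding q_def r_def b_def using K by (intro mult_mono) auto
      finally have A: "norm (ainv Q - ainv P) \<le> q * (r * b * K\<^sup>2)"
        by (simp add: power2_eq_square algebra_simps)
      have "r * b * K\<^sup>2 \<le> 1 / 2" using r(2) b K(1) by (simp add: field_simps)
      then have "norm (ainv Q - ainv P) \<le> q * (1 / 2)"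
        by (intro order_trans[OF A] mult_left_mono) (auto simp: q_def)
      then have "q \<le> 2 * b"
        using norm_triangle_ineq2[of "ainv Q" "ainv P"] unfolding q_def b_def by simp
      then have "norm (ainv Q - ainv P) \<le> 2 * b * (r * b * K\<^sup>2)"
        using r(1) b by (intro order_trans[OF A] mult_right_mono) auto
      also have "\<dots> < e" using r(3) b K(1) by (simp add: field_simps)
      finally show ?thesis by (simp add: dist_norm)
    qed
    then show ?thesis using d by blast
  qed
  then show ?thesis unfolding continuous_on_iff by blast
qed

lemma has_dirderiv_ainv:
  assumes P: "P \<in> posdef" and v: "v \<in> hermitian"
  shows "has_dirderiv ainv (- (ainv P \<cdot> v \<cdot> ainv P)) v P"
proof -
  obtain S where S: "open S" "(0::real) \<in> S" "\<And>t. t \<in> S \<Longrightarrow> P + t *\<^sub>R v \<in> posdef"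
    using line_near_in_U[OF P v] by blast
  have near: "\<forall>\<^sub>F t in at 0. t \<in> S" using S(1,2) by (rule eventually_at_in_open')
  have "((\<lambda>t. P + t *\<^sub>R v) \<longlongrightarrow> P) (at (0::real))"
    by (auto intro!: tendsto_eq_intros)
  moreover have "\<forall>\<^sub>F t in at 0. P + t *\<^sub>R v \<in> posdef"
    using near by (rule eventually_mono) (rule S(3))
  ultimately have "((\<lambda>t. ainv (P + t *\<^sub>R v)) \<longlongrightarrow> ainv P) (at 0)"
    by (rule continuous_on_tendsto_compose[OF continuous_on_ainv _ P])
  then have "((\<lambda>t. - (ainv (P + t *\<^sub>R v) \<cdot> v \<cdot> ainv P)) \<longlongrightarrow> - (ainv P \<cdot> v \<cdot> ainv P)) (at 0)"
    by (intro tendsto_minus mult.tendsto tendsto_const)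
  moreover have "\<forall>\<^sub>F t in at 0. - (ainv (P + t *\<^sub>R v) \<cdot> v \<cdot> ainv P) =
      (ainv (P + t *\<^sub>R v) - ainv (P + 0 *\<^sub>R v)) /\<^sub>R t"
    using near eventually_neq_at_within[of 0 0 UNIV]
  proof eventually_elim
    case (elim t)
    then show ?case
      using ainv_diff[OF P S(3)[OF elim(1)]] by (simp add: mult.scaleR_left mult.scaleR_right)
  qed
  ultimately show ?thesis
    unfolding has_vector_derivative_iff_quotient by (rule Lim_transform_eventually)
qed

text \<open>
  The derivative of the inverse is a polynomial in the inverse and the direction, so that class
  \<open>C\<^sup>k\<close> of the inverse implies class \<open>C\<^bsup>k+1\<^esup>\<close>.
\<close>

lemma smooth_on_ainv: "smooth_on hermitian posdef ainv"
proof -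
  have "Ck_on k hermitian posdef ainv" for k
  proof (induction k)
    case (Suc k)
    show ?case
    proof (rule Ck_on_SucI[OF continuous_on_ainv has_dirderiv_ainv])
      show "Ck_on k hermitian posdef (\<lambda>P. - (ainv P \<cdot> v \<cdot> ainv P))" for v
        by (intro Ck_on_bounded_linear[OF bounded_linear_minus[OF bounded_linear_ident]]
            Ck_on_bounded_bilinear[OF bounded_bilinear_mult] Ck_on_const Suc)
    qed
  qed (simp add: continuous_on_ainv)
  then show ?thesis unfolding smooth_on_def by blast
qed

lemma smooth_on_mult:
  "smooth_on hermitian posdef f \<Longrightarrow> smooth_on hermitian posdef h \<Longrightarrow> smooth_on hermitian posdef (\<lambda>P. f P \<cdot> h P)"
  by (rule smooth_on_bounded_bilinear[OF bounded_bilinear_mult])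

lemma metric_sym: "metric P x y = metric P y x"
  unfolding metric_def using tr_commute[of "ainv P \<cdot> x" "ainv P \<cdot> y"] by (simp add: mult_assoc)

lemma metric_add: "metric P (x + y) z = metric P x z + metric P y z"
  and metric_scaleR: "metric P (r *\<^sub>R x) y = r * metric P x y"
  unfolding metric_def
  by (simp_all add: mult.add_left mult.add_right mult.scaleR_left mult.scaleR_right tr_add tr_scaleR algebra_simps)

lemma metric_pos:
  assumes "P \<in> posdef" "x \<in> hermitian" "x \<noteq> 0"
  shows "metric P x x > 0"
  using sandwich_pos[OF ainv_in_posdef[OF assms(1)] assms(3)] assms(2) c_pos
  unfolding metric_def hermitian_def by simp

lemma riemannian_manifold_metric: "riemannian_manifold hermitian posdef metric"
proof -
  have "smooth_on hermitian posdef (\<lambda>P. metric P x y)" for x y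
    unfolding metric_def tr_def
    by (intro smooth_on_bounded_linear[OF bounded_linear_mult_right]
        smooth_on_bounded_linear[OF bounded_linear_inner_right] smooth_on_mult smooth_on_ainv smooth_on_const)
  then show ?thesis
    unfolding riemannian_manifold_def
    using subspace_hermitian openin_posdef metric_add metric_scaleR metric_sym metric_pos by blast
qed

end

section \<open>Connection and curvature of the trace metric\<close>

context hilbert_algebra begin

text \<open>
  The Christoffel symbols, as a bilinear map, of the metric in the linear coordinates of the cone.
\<close>

definition christoffel :: "'a \<Rightarrow> 'a \<Rightarrow> 'a \<Rightarrow> 'a" where
  "christoffel P x y = - ((1/2) *\<^sub>R (x \<cdot> ainv P \<cdot> y + y \<cdot> ainv P \<cdot> x))"

definition connection :: "('a \<Rightarrow> 'a) \<Rightarrow> ('a \<Rightarrow> 'a) \<Rightarrow> 'a \<Rightarrow> 'a" where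
  "connection X Y P = dirderiv Y (X P) P + christoffel P (X P) (Y P)"

abbreviation fields :: "('a \<Rightarrow> 'a) set" where "fields \<equiv> vector_fields hermitian posdef"

lemma star_ainv: "P \<in> posdef \<Longrightarrow> star (ainv P) = ainv P"
  by (rule posdef_star[OF ainv_in_posdef])

lemma christoffel_commute: "christoffel P x y = christoffel P y x"
  unfolding christoffel_def by (simp add: add.commute)

lemma christoffel_add_left: "christoffel P (x + y) z = christoffel P x z + christoffel P y z"
  and christoffel_add_right: "christoffel P z (x + y) = christoffel P z x + christoffel P z y"
  and christoffel_diff_left: "christoffel P (x - y) z = christoffel P x z - christoffel P y z"
  and christoffel_scaleR_left: "christoffel P (r *\<^sub>R x) z = r *\<^sub>R christoffel P x z"
  and christoffel_scaleR_right: "christoffel P z (r *\<^sub>R x) = r *\<^sub>R christoffel P z x"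
  unfolding christoffel_def
  by (simp_all add: mult.add_left mult.add_right mult.diff_left mult.diff_right
      mult.scaleR_left mult.scaleR_right scaleR_add_right scaleR_diff_right)

lemma christoffel_hermitian:
  assumes "P \<in> posdef" "x \<in> hermitian" "y \<in> hermitian"
  shows "christoffel P x y \<in> hermitian"
proof -
  have "star (x \<cdot> ainv P \<cdot> y + y \<cdot> ainv P \<cdot> x) = x \<cdot> ainv P \<cdot> y + y \<cdot> ainv P \<cdot> x"
    using assms(2,3) by (simp add: star_add star_mult star_ainv[OF assms(1)] hermitian_def mult_assoc)
  then have "x \<cdot> ainv P \<cdot> y + y \<cdot> ainv P \<cdot> x \<in> hermitian" by (simp add: hermitian_def)
  then show ?thesis
    unfolding christoffel_def by (intro subspace_neg subspace_scale subspace_hermitian)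
qed

lemma smooth_on_christoffel:
  assumes "smooth_on hermitian posdef X" "smooth_on hermitian posdef Y"
  shows "smooth_on hermitian posdef (\<lambda>P. christoffel P (X P) (Y P))"
  unfolding christoffel_def
  by (intro smooth_on_bounded_linear[OF bounded_linear_minus[OF bounded_linear_ident]]
      smooth_on_bounded_linear[OF bounded_linear_scaleR_right] smooth_on_add smooth_on_mult
      smooth_on_ainv assms)

lemma connection_in_fields:
  assumes X: "X \<in> fields" and Y: "Y \<in> fields"
  shows "connection X Y \<in> fields"
proof -
  have "smooth_on hermitian posdef (connection X Y)"
    unfolding connection_def[abs_def] using X Y
    by (intro smooth_on_add smooth_on_dirderiv_along_field smooth_on_christoffel vector_fields_smooth)
  moreover have "connection X Y P \<in> hermitian" if "P \<in> posdef" for P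
    unfolding connection_def using X Y that
    by (intro subspace_add subspace_hermitian dirderiv_in_V christoffel_hermitian vector_fields_in_V)
  ultimately show ?thesis unfolding vector_fields_def by blast
qed

lemma affine_connection_connection: "affine_connection hermitian posdef connection"
  unfolding affine_connection_def
proof (intro conjI ballI allI impI)
  fix X Y assume X: "X \<in> fields" and Y: "Y \<in> fields"
  show "connection X Y \<in> fields" using X Y by (rule connection_in_fields)
  fix P assume P: "P \<in> posdef"
  note XP = vector_fields_in_V[OF X P] and smooth = vector_fields_smooth[OF X] vector_fields_smooth[OF Y]
  {
    fix Z assume Z: "Z \<in> fields"
    show "connection (\<lambda>Q. X Q + Y Q) Z P = connection X Z P + connection Y Z P"
      unfolding connection_def
      by (simp add: christoffel_add_left dirderiv_add_direction[OF vector_fields_smooth[OF Z] XP vector_fields_in_V[OF Y P] P])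
    show "connection X (\<lambda>Q. Y Q + Z Q) P = connection X Y P + connection X Z P"
      unfolding connection_def
      by (simp add: christoffel_add_right dirderiv_add[OF smooth(2) vector_fields_smooth[OF Z] XP P])
  }
  fix f :: "'a \<Rightarrow> real" assume f: "smooth_on hermitian posdef f"
  show "connection (\<lambda>Q. f Q *\<^sub>R X Q) Y P = f P *\<^sub>R connection X Y P"
    unfolding connection_def
    by (simp add: christoffel_scaleR_left scaleR_add_right dirderiv_scaleR[OF smooth(2) XP P])
  show "connection X (\<lambda>Q. f Q *\<^sub>R Y Q) P = dirderiv f (X P) P *\<^sub>R Y P + f P *\<^sub>R connection X Y P"
    unfolding connection_def
    by (simp add: christoffel_scaleR_right scaleR_add_right
        dirderiv_bounded_bilinear[OF bounded_bilinear_scaleR f smooth(2) XP P])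
qed

lemma dirderiv_mult:
  "smooth_on hermitian posdef X \<Longrightarrow> smooth_on hermitian posdef Y \<Longrightarrow> v \<in> hermitian \<Longrightarrow> P \<in> posdef \<Longrightarrow>
    dirderiv (\<lambda>P. X P \<cdot> Y P) v P = X P \<cdot> dirderiv Y v P + dirderiv X v P \<cdot> Y P"
  by (rule dirderiv_bounded_bilinear[OF bounded_bilinear_mult])

lemma dirderiv_ainv:
  "v \<in> hermitian \<Longrightarrow> P \<in> posdef \<Longrightarrow> dirderiv ainv v P = - (ainv P \<cdot> v \<cdot> ainv P)"
  by (intro dirderiv_eqI has_dirderiv_ainv)

text \<open>
  Besides the product rule in \<open>X\<close> and \<open>Y\<close>, there is the derivative of the inverse inside \<open>christoffel\<close>,
  which produces the products of three factors. They are one of the two sources of curvature.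
\<close>

lemma dirderiv_christoffel:
  assumes X: "smooth_on hermitian posdef X" and Y: "smooth_on hermitian posdef Y"
    and v: "v \<in> hermitian" and P: "P \<in> posdef"
  shows "dirderiv (\<lambda>Q. christoffel Q (X Q) (Y Q)) v P =
    christoffel P (dirderiv X v P) (Y P) + christoffel P (X P) (dirderiv Y v P)
    + (1/2) *\<^sub>R (X P \<cdot> ainv P \<cdot> v \<cdot> ainv P \<cdot> Y P + Y P \<cdot> ainv P \<cdot> v \<cdot> ainv P \<cdot> X P)"
proof -
  note I = smooth_on_ainv
  have deriv: "dirderiv (\<lambda>Q. X Q \<cdot> ainv Q \<cdot> Y Q) v P =
      X P \<cdot> ainv P \<cdot> dirderiv Y v P + dirderiv X v P \<cdot> ainv P \<cdot> Y P - X P \<cdot> ainv P \<cdot> v \<cdot> ainv P \<cdot> Y P"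
    if X: "smooth_on hermitian posdef X" and Y: "smooth_on hermitian posdef Y" for X Y
    unfolding dirderiv_mult[OF smooth_on_mult[OF X I] Y v P] dirderiv_mult[OF X I v P] dirderiv_ainv[OF v P]
    by (simp add: mult.add_left mult.diff_left mult.minus_left mult.minus_right mult_assoc)
  have smooth: "smooth_on hermitian posdef (\<lambda>Q. X Q \<cdot> ainv Q \<cdot> Y Q)"
    if "smooth_on hermitian posdef X" "smooth_on hermitian posdef Y" for X Y
    using that by (intro smooth_on_mult I)
  have "bounded_linear (\<lambda>x::'a. - ((1/2) *\<^sub>R x))"
    by (intro bounded_linear_minus bounded_linear_scaleR_right)
  from dirderiv_bounded_linear[OF this smooth_on_add[OF smooth[OF X Y] smooth[OF Y X]] v P]
  have "dirderiv (\<lambda>Q. christoffel Q (X Q) (Y Q)) v P =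
    - ((1/2) *\<^sub>R (dirderiv (\<lambda>Q. X Q \<cdot> ainv Q \<cdot> Y Q + Y Q \<cdot> ainv Q \<cdot> X Q) v P))"
    unfolding christoffel_def .
  also have "\<dots> = christoffel P (dirderiv X v P) (Y P) + christoffel P (X P) (dirderiv Y v P)
    + (1/2) *\<^sub>R (X P \<cdot> ainv P \<cdot> v \<cdot> ainv P \<cdot> Y P + Y P \<cdot> ainv P \<cdot> v \<cdot> ainv P \<cdot> X P)"
    unfolding dirderiv_add[OF smooth[OF X Y] smooth[OF Y X] v P] deriv[OF X Y] deriv[OF Y X] christoffel_def
    by (simp add: scaleR_add_right scaleR_diff_right)
  finally show ?thesis .
qed

text \<open>
  Differentiating the two inverses in the metric gives \<open>- tr (B v B y B z) - tr (B y B v B z)\<close>. The two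
  Christoffel terms yield half of each of these and, up to a cyclic permutation under
  the trace, the other halves.
\<close>

lemma dirderiv_metric:
  assumes Y: "smooth_on hermitian posdef Y" and Z: "smooth_on hermitian posdef Z"
    and v: "v \<in> hermitian" and P: "P \<in> posdef"
  shows "dirderiv (\<lambda>Q. metric Q (Y Q) (Z Q)) v P =
    metric P (dirderiv Y v P + christoffel P v (Y P)) (Z P) + metric P (Y P) (dirderiv Z v P + christoffel P v (Z P))"
proof -
  note I = smooth_on_ainv
  let ?B = "ainv P"
  have lin: "bounded_linear (\<lambda>x::'a. c * tr x)"
    unfolding tr_def by (rule bounded_linear_compose[OF bounded_linear_mult_right bounded_linear_inner_right])
  have outer: "dirderiv (\<lambda>Q. metric Q (Y Q) (Z Q)) v P = c * tr (dirderiv (\<lambda>Q. ainv Q \<cdot> Y Q \<cdot> ainv Q \<cdot> Z Q) v P)"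
    unfolding metric_def by (rule dirderiv_bounded_linear[OF lin _ v P]) (intro smooth_on_mult I Y Z)
  have inner: "dirderiv (\<lambda>Q. ainv Q \<cdot> Y Q \<cdot> ainv Q \<cdot> Z Q) v P =
      ?B \<cdot> Y P \<cdot> ?B \<cdot> dirderiv Z v P + ?B \<cdot> dirderiv Y v P \<cdot> ?B \<cdot> Z P
      - ?B \<cdot> v \<cdot> ?B \<cdot> Y P \<cdot> ?B \<cdot> Z P - ?B \<cdot> Y P \<cdot> ?B \<cdot> v \<cdot> ?B \<cdot> Z P"
    unfolding dirderiv_mult[OF smooth_on_mult[OF smooth_on_mult[OF I Y] I] Z v P]
      dirderiv_mult[OF smooth_on_mult[OF I Y] I v P] dirderiv_mult[OF I Y v P] dirderiv_ainv[OF v P]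
    by (simp add: mult.add_left mult.diff_left mult.minus_left mult.minus_right mult_assoc)
  have lhs: "dirderiv (\<lambda>Q. metric Q (Y Q) (Z Q)) v P = c * tr (?B \<cdot> Y P \<cdot> ?B \<cdot> dirderiv Z v P)
      + c * tr (?B \<cdot> dirderiv Y v P \<cdot> ?B \<cdot> Z P)
      - c * tr (?B \<cdot> v \<cdot> ?B \<cdot> Y P \<cdot> ?B \<cdot> Z P) - c * tr (?B \<cdot> Y P \<cdot> ?B \<cdot> v \<cdot> ?B \<cdot> Z P)"
    unfolding outer inner by (simp add: tr_add tr_diff algebra_simps)
  have cyclic: "tr (?B \<cdot> (Y P \<cdot> (?B \<cdot> (Z P \<cdot> (?B \<cdot> v))))) = tr (?B \<cdot> (v \<cdot> (?B \<cdot> (Y P \<cdot> (?B \<cdot> Z P)))))"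
    using tr_commute[of "?B \<cdot> (Y P \<cdot> (?B \<cdot> Z P))" "?B \<cdot> v"] by (simp add: mult_assoc)
  show ?thesis
    unfolding lhs unfolding metric_def christoffel_def
    by (simp add: mult_assoc mult.add_left mult.add_right mult.diff_left mult.diff_right mult.minus_left mult.minus_right
        mult.scaleR_left mult.scaleR_right tr_add tr_diff tr_minus tr_scaleR cyclic algebra_simps)
qed

lemma is_levi_civita_connection: "is_levi_civita hermitian posdef metric connection"
  unfolding is_levi_civita_def
proof (intro conjI ballI)
  show "affine_connection hermitian posdef connection" by (rule affine_connection_connection)
  fix X Y assume X: "X \<in> fields" and Y: "Y \<in> fields"
  show "connection X Y P - connection Y X P = lie_bracket X Y P" if "P \<in> posdef" for P
    unfolding connection_def lie_bracket_def by (simp add: christoffel_commute[of P "X P"])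
  show "dirderiv (\<lambda>Q. metric Q (Y Q) (Z Q)) (X P) P =
      metric P (connection X Y P) (Z P) + metric P (Y P) (connection X Z P)"
    if "Z \<in> fields" "P \<in> posdef" for Z P
    unfolding connection_def using X Y that
    by (intro dirderiv_metric vector_fields_smooth vector_fields_in_V)
qed

text \<open>
  Only the terms that are not symmetric under the exchange of \<open>X\<close> and \<open>Y\<close>, and are not cancelled by the
  bracket, survive in the curvature: those in the last two lines.
\<close>

lemma connection_of_connection:
  assumes X: "X \<in> fields" and Y: "Y \<in> fields" and Z: "Z \<in> fields" and P: "P \<in> posdef"
  shows "connection X (connection Y Z) P =
    dirderiv Z (dirderiv Y (X P) P) P + dirderiv (dirderiv Z (X P)) (Y P) P
    + christoffel P (dirderiv Y (X P) P) (Z P) + christoffel P (Y P) (dirderiv Z (X P) P) + christoffel P (X P) (dirderiv Z (Y P) P)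
    + (1/2) *\<^sub>R (Y P \<cdot> ainv P \<cdot> X P \<cdot> ainv P \<cdot> Z P + Z P \<cdot> ainv P \<cdot> X P \<cdot> ainv P \<cdot> Y P)
    + christoffel P (X P) (christoffel P (Y P) (Z P))"
proof -
  note XP = vector_fields_in_V[OF X P] and Y' = vector_fields_smooth[OF Y] and Z' = vector_fields_smooth[OF Z]
  have "dirderiv (connection Y Z) (X P) P =
      dirderiv (\<lambda>Q. dirderiv Z (Y Q) Q) (X P) P + dirderiv (\<lambda>Q. christoffel Q (Y Q) (Z Q)) (X P) P"
    unfolding connection_def[abs_def]
    by (rule dirderiv_add[OF smooth_on_dirderiv_along_field[OF Y Z'] smooth_on_christoffel[OF Y' Z'] XP P])
  then show ?thesis
    unfolding connection_def[of X] dirderiv_along_field[OF Y Z' XP P] dirderiv_christoffel[OF Y' Z' XP P]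
    by (simp add: connection_def[of Y] christoffel_add_right)
qed

text \<open>
  In the product \<open>x \<circ> y = x \<cdot> B \<cdot> y\<close>, whose unit is \<open>P\<close>, the right-hand side is a quarter of
  \<open>- [[x, y], z]\<close>. The derivative of the Christoffel symbols contributes twice the result, and
  their iterated products subtract it once.
\<close>

lemma riemann_curvature_metric:
  assumes X: "X \<in> fields" and Y: "Y \<in> fields" and Z: "Z \<in> fields" and P: "P \<in> posdef"
  defines "B \<equiv> ainv P" and "x \<equiv> X P" and "y \<equiv> Y P" and "z \<equiv> Z P"
  shows "riemann_curvature hermitian posdef metric X Y Z P =
    (1/4) *\<^sub>R (y \<cdot> B \<cdot> x \<cdot> B \<cdot> z + z \<cdot> B \<cdot> x \<cdot> B \<cdot> y - x \<cdot> B \<cdot> y \<cdot> B \<cdot> z - z \<cdot> B \<cdot> y \<cdot> B \<cdot> x)"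
proof -
  note Z' = vector_fields_smooth[OF Z]
  have connection_local: "connection A F P = connection A G P"
    if "A \<in> fields" "P \<in> posdef" "\<And>Q. Q \<in> posdef \<Longrightarrow> F Q = G Q" for A F G P
    unfolding connection_def
    using dirderiv_cong[OF that(2) vector_fields_in_V[OF that(1,2)] that(3)] that(3)[OF that(2)] by simp
  have XP: "x \<in> hermitian" and YP: "y \<in> hermitian"
    unfolding x_def y_def using X Y P by (auto intro: vector_fields_in_V)
  define dXY where "dXY = dirderiv Y x P"
  define dYX where "dYX = dirderiv X y P"
  have dV: "dXY \<in> hermitian" "dYX \<in> hermitian"
    unfolding dXY_def dYX_def using X Y XP YP P by (auto intro: dirderiv_in_V)
  have bracket: "connection (lie_bracket X Y) Z P =
      dirderiv Z dXY P - dirderiv Z dYX P + christoffel P dXY z - christoffel P dYX z"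
    unfolding connection_def lie_bracket_def x_def[symmetric] y_def[symmetric] z_def[symmetric] dXY_def[symmetric] dYX_def[symmetric]
    by (simp add: dirderiv_diff_direction[OF Z' dV P] christoffel_diff_left)
  have "riemann_curvature hermitian posdef metric X Y Z P =
      connection X (connection Y Z) P - connection Y (connection X Z) P - connection (lie_bracket X Y) Z P"
    by (rule riemann_curvature_eq[OF riemannian_manifold_metric is_levi_civita_connection connection_local X Y Z P])
  also have "\<dots> = (1/2) *\<^sub>R (y \<cdot> B \<cdot> x \<cdot> B \<cdot> z + z \<cdot> B \<cdot> x \<cdot> B \<cdot> y)
      - (1/2) *\<^sub>R (x \<cdot> B \<cdot> y \<cdot> B \<cdot> z + z \<cdot> B \<cdot> y \<cdot> B \<cdot> x)
      + christoffel P x (christoffel P y z) - christoffel P y (christoffel P x z)"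
    unfolding connection_of_connection[OF X Y Z P] connection_of_connection[OF Y X Z P] bracket
      x_def[symmetric] y_def[symmetric] z_def[symmetric] dXY_def[symmetric] dYX_def[symmetric] B_def[symmetric]
    using dirderiv_commute[OF Z' XP YP P] by simp
  finally have R: "riemann_curvature hermitian posdef metric X Y Z P = \<dots>" .
  have nested: "christoffel P u (christoffel P v w) = (1/4) *\<^sub>R (u \<cdot> B \<cdot> v \<cdot> B \<cdot> w + u \<cdot> B \<cdot> w \<cdot> B \<cdot> v
      + v \<cdot> B \<cdot> w \<cdot> B \<cdot> u + w \<cdot> B \<cdot> v \<cdot> B \<cdot> u)" for u v w
    unfolding christoffel_def B_def[symmetric]
    by (simp add: mult.add_left mult.add_right mult.diff_left mult.diff_right mult.minus_left
        mult.minus_right mult.scaleR_left mult.scaleR_right scaleR_add_right scaleR_diff_right mult_assoc)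
  \<comment> \<open>everything is brought to the common factor one quarter, so that it can be collected\<close>
  have half: "(1/2) *\<^sub>R u = (1/4) *\<^sub>R (u + u)" for u :: 'a
    by (simp add: scaleR_2[symmetric])
  show ?thesis
    unfolding R nested half scaleR_diff_right[symmetric] scaleR_add_right[symmetric] by simp
qed

text \<open>
  With the commutator \<open>w = x \<cdot> B \<cdot> y - y \<cdot> B \<cdot> x\<close>, the curvature form is a negative multiple of
  \<open>tr (B \<cdot> star w \<cdot> B \<cdot> w)\<close>: both reduce by cyclic permutations under the trace to the same two words. Since
  \<open>w\<close> is skew, not Hermitian, this is \<open>sandwich_pos\<close> for an element outside of the tangent space.
\<close>

lemma curvature_form_nonpos:
  assumes X: "X \<in> fields" and Y: "Y \<in> fields" and P: "P \<in> posdef"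
  shows "metric P (riemann_curvature hermitian posdef metric X Y Y P) (X P) \<le> 0"
proof -
  define B where "B = ainv P"
  define x where "x = X P"
  define y where "y = Y P"
  define w where "w = x \<cdot> B \<cdot> y - y \<cdot> B \<cdot> x"
  have herm: "star x = x" "star y = y" "star B = B"
    using vector_fields_in_V[OF X P] vector_fields_in_V[OF Y P] star_ainv[OF P]
    unfolding x_def y_def B_def hermitian_def by auto
  have star_w: "star w = y \<cdot> B \<cdot> x - x \<cdot> B \<cdot> y"
    unfolding w_def by (simp add: star_diff star_mult herm mult_assoc)
  let ?a = "tr (B \<cdot> (x \<cdot> (B \<cdot> (y \<cdot> (B \<cdot> (y \<cdot> (B \<cdot> x)))))))"
  let ?b = "tr (B \<cdot> (x \<cdot> (B \<cdot> (y \<cdot> (B \<cdot> (x \<cdot> (B \<cdot> y)))))))"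
  have cyclic:
    "tr (B \<cdot> (y \<cdot> (B \<cdot> (x \<cdot> (B \<cdot> (y \<cdot> (B \<cdot> x))))))) = ?b"
    "tr (B \<cdot> (y \<cdot> (B \<cdot> (y \<cdot> (B \<cdot> (x \<cdot> (B \<cdot> x))))))) = ?a"
    "tr (B \<cdot> (y \<cdot> (B \<cdot> (x \<cdot> (B \<cdot> (x \<cdot> (B \<cdot> y))))))) = ?a"
    using tr_commute[of "B \<cdot> y" "B \<cdot> (x \<cdot> (B \<cdot> (y \<cdot> (B \<cdot> x))))"]
      tr_commute[of "B \<cdot> (y \<cdot> (B \<cdot> (y \<cdot> (B \<cdot> x))))" "B \<cdot> x"]
      tr_commute[of "B \<cdot> (y \<cdot> (B \<cdot> x))" "B \<cdot> (x \<cdot> (B \<cdot> y))"]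
    by (simp_all add: mult_assoc)
  have "tr (B \<cdot> star w \<cdot> B \<cdot> w) = 2 * ?a - 2 * ?b"
    unfolding star_w unfolding w_def
    by (simp add: mult.diff_left mult.diff_right mult_assoc tr_diff cyclic)
  moreover have "tr (B \<cdot> star w \<cdot> B \<cdot> w) \<ge> 0"
    using sandwich_pos[OF ainv_in_posdef[OF P], of w] unfolding B_def
    by (cases "w = 0") (auto simp: tr_def mult.zero_right less_imp_le)
  ultimately have "(c / 2) * (?b - ?a) \<le> 0"
    using c_pos by (intro mult_nonneg_nonpos) auto
  moreover have "metric P (riemann_curvature hermitian posdef metric X Y Y P) (X P) = (c / 2) * (?b - ?a)"
    unfolding riemann_curvature_metric[OF X Y Y P] metric_def x_def[symmetric] y_def[symmetric] B_def[symmetric]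
    by (simp add: mult.add_left mult.add_right mult.diff_left mult.diff_right mult.scaleR_left
        mult.scaleR_right mult_assoc tr_add tr_diff tr_scaleR cyclic field_simps)
  ultimately show ?thesis by (simp only:)
qed

lemma metric_cauchy_schwarz:
  assumes P: "P \<in> posdef" and x: "x \<in> hermitian" and y: "y \<in> hermitian"
  shows "(metric P x y)\<^sup>2 \<le> metric P x x * metric P y y"
proof (cases "y = 0")
  case True
  then show ?thesis using metric_scaleR[of P 0 0 x] metric_scaleR[of P 0 0 0] metric_sym[of P x 0] by simp
next
  case False
  define a where "a = metric P y y"
  define b where "b = metric P x y"
  define u where "u = a *\<^sub>R x + (- b) *\<^sub>R y"
  have a: "a > 0" unfolding a_def by (rule metric_pos[OF P y False])
  have u: "u \<in> hermitian" unfolding u_def using x y by (intro subspace_add subspace_scale subspace_hermitian)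
  have lin: "metric P (r *\<^sub>R x + s *\<^sub>R y) z = r * metric P x z + s * metric P y z" for r s z
    by (simp add: metric_add metric_scaleR)
  have lin_right: "metric P z (r *\<^sub>R x + s *\<^sub>R y) = r * metric P z x + s * metric P z y" for r s z
    using lin[of r s z] by (simp only: metric_sym[of P z])
  have "metric P y x = b" "metric P x y = b" "metric P y y = a"
    unfolding a_def b_def by (simp_all only: metric_sym[of P y x])
  then have "metric P u u = a * (a * metric P x x - b\<^sup>2)"
    unfolding u_def lin lin_right by (simp add: power2_eq_square algebra_simps)
  moreover have "metric P u u \<ge> 0"
    using metric_pos[OF P u] metric_scaleR[of P 0 0 0] by (cases "u = 0") auto
  ultimately show ?thesis using a by (simp add: zero_le_mult_iff a_def b_def mult.commute)
qed

theorem nonpositive_curvature_metric: "nonpositive_curvature hermitian posdef metric"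
  unfolding nonpositive_curvature_def
proof (intro ballI impI)
  fix P X Y assume P: "P \<in> posdef" and X: "X \<in> fields" and Y: "Y \<in> fields"
  have "(metric P (X P) (Y P))\<^sup>2 \<le> metric P (X P) (X P) * metric P (Y P) (Y P)"
    using X Y P by (intro metric_cauchy_schwarz vector_fields_in_V)
  then show "sectional_curvature hermitian posdef metric X Y P \<le> 0"
    unfolding sectional_curvature_def using curvature_form_nonpos[OF X Y P]
    by (intro divide_nonpos_nonneg) auto
qed

end

section \<open>Tensors under the T-product\<close>

lemma sum_UNIV_prod: "(\<Sum>x\<in>UNIV. f x) = (\<Sum>a\<in>UNIV. \<Sum>b\<in>UNIV. f (a, b))"
  by (simp add: sum.cartesian_product)

lemma tprod_nth:
  fixes A :: "('m::finite, 'n::finite, 'p::finite) tensor" and B :: "('n, 'q::finite, 'p) tensor"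
  shows "(A \<star> B) $ k $ i $ j = (\<Sum>l\<in>UNIV. \<Sum>m\<in>UNIV. A $ (k - l) $ i $ m * B $ l $ m $ j)"
  by (simp add: tprod_def fold_tensor_def unfold_tensor_def bcirc_def matrix_matrix_mult_def
      sum_UNIV_prod)

text \<open>
  Identities of the T-product are inherited from matrix multiplication, because \<open>bcirc\<close> is an
  injective homomorphism.
\<close>

lemma bcirc_inject: "bcirc A = bcirc B \<Longrightarrow> A = B"
  unfolding vec_eq_iff bcirc_def
  by (metis (no_types, lifting) diff_zero fst_conv snd_conv vec_lambda_beta)

lemma bcirc_tprod:
  fixes A :: "('m::finite, 'n::finite, 'p::finite) tensor" and B :: "('n, 'q::finite, 'p) tensor"
  shows "bcirc (A \<star> B) = bcirc A ** bcirc B"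
proof -
  have "(\<Sum>l\<in>UNIV. \<Sum>m\<in>UNIV. A $ (fst r - fst c - l) $ snd r $ m * B $ l $ m $ snd c) =
    (\<Sum>s\<in>UNIV. \<Sum>m\<in>UNIV. A $ (fst r - s) $ snd r $ m * B $ (s - fst c) $ m $ snd c)"
    for r :: "'p mod_ring \<times> 'm" and c :: "'p mod_ring \<times> 'q"
    by (rule sum.reindex_bij_witness[where i = "\<lambda>s. s - fst c" and j = "\<lambda>l. l + fst c"])
       (simp_all add: diff_diff_eq add.commute)
  then show ?thesis
    by (simp add: vec_eq_iff bcirc_def tprod_nth matrix_matrix_mult_def
      sum_UNIV_prod)
qed

lemma bcirc_tident: "bcirc (tident :: ('n::finite, 'n, 'p::finite) tensor) = mat 1"
  by (auto simp: vec_eq_iff bcirc_def tident_def mat_def prod_eq_iff)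

lemma tprod_assoc: "A \<star> B \<star> C = A \<star> (B \<star> C)"
  by (rule bcirc_inject) (simp add: bcirc_tprod matrix_mul_assoc)

lemma tprod_tident_left: "tident \<star> A = A"
  by (rule bcirc_inject) (simp add: bcirc_tprod bcirc_tident)

lemma tprod_tident_right: "A \<star> tident = A"
  by (rule bcirc_inject) (simp add: bcirc_tprod bcirc_tident)

lemma bounded_bilinear_tprod:
  "bounded_bilinear ((\<star>) :: ('m::finite, 'n::finite, 'p::finite) tensor \<Rightarrow> ('n, 'q::finite, 'p) tensor \<Rightarrow> _)"
  unfolding bilinear_conv_bounded_bilinear[symmetric] bilinear_def
  by (intro conjI allI linearI)
     (simp_all add: vec_eq_iff tprod_nth algebra_simps sum.distrib scaleR_sum_right)

lemma inner_eq_Re_tinner: "A \<bullet> B = Re (tinner A B)"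
  by (simp add: inner_vec_def tinner_def inner_complex_def)

lemma cnj_tinner: "cnj (tinner A B) = tinner B A"
  by (simp add: tinner_def mult.commute)

lemma tinner_tprod_left:
  fixes A :: "('m::finite, 'n::finite, 'p::finite) tensor" and B :: "('n, 'q::finite, 'p) tensor"
  shows "tinner (A \<star> B) C = tinner B (tadjoint A \<star> C)"
proof -
  have "tinner (A \<star> B) C =
    (\<Sum>(k, i, j, l, m)\<in>UNIV. cnj (B $ l $ m $ j) * (cnj (A $ (k - l) $ i $ m) * C $ k $ i $ j))"
    by (simp add: tinner_def tprod_nth sum_distrib_left sum_distrib_right sum_UNIV_prod mult_ac)
  also have "\<dots> =
    (\<Sum>(l, m, j, k, i)\<in>UNIV. cnj (B $ l $ m $ j) * (cnj (A $ (k - l) $ i $ m) * C $ k $ i $ j))"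
    by (rule sum.reindex_bij_witness[where i = "\<lambda>(l, m, j, k, i). (k, i, j, l, m)"
          and j = "\<lambda>(k, i, j, l, m). (l, m, j, k, i)"]) auto
  also have "\<dots> = tinner B (tadjoint A \<star> C)"
    by (simp add: tinner_def tprod_nth tadjoint_def sum_distrib_left sum_UNIV_prod)
  finally show ?thesis .
qed

lemma tinner_tprod_right:
  fixes A :: "('m::finite, 'n::finite, 'p::finite) tensor" and B :: "('q::finite, 'm, 'p) tensor"
  shows "tinner (B \<star> A) C = tinner B (C \<star> tadjoint A)"
proof -
  have "tinner (B \<star> A) C =
    (\<Sum>(k, i, j, l, m)\<in>UNIV. cnj (B $ (k - l) $ i $ m) * (C $ k $ i $ j * cnj (A $ l $ m $ j)))"
    by (simp add: tinner_def tprod_nth sum_distrib_left sum_distrib_right sum_UNIV_prod mult_ac)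
  also have "\<dots> =
    (\<Sum>(s, i, m, l, j)\<in>UNIV. cnj (B $ s $ i $ m) * (C $ (s - l) $ i $ j * cnj (A $ (- l) $ m $ j)))"
    \<comment> \<open>substituting \<open>s = k - l\<close> and changing the sign of \<open>l\<close>\<close>
    by (rule sum.reindex_bij_witness[where i = "\<lambda>(s, i, m, l, j). (s - l, i, j, - l, m)"
          and j = "\<lambda>(k, i, j, l, m). (k - l, i, m, - l, j)"]) auto
  also have "\<dots> = tinner B (C \<star> tadjoint A)"
    by (simp add: tinner_def tprod_nth tadjoint_def sum_distrib_left sum_UNIV_prod)
  finally show ?thesis .
qed

lemma hilbert_algebra_tensor:
  "hilbert_algebra ((\<star>) :: ('n::finite, 'n, 'p::finite) tensor \<Rightarrow> _ \<Rightarrow> _) tident tadjoint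
    (real CARD('p))"
proof (rule hilbert_algebra.intro)
  fix X Y Z :: "('n, 'n, 'p) tensor"
  show "(X \<star> Y) \<bullet> Z = Y \<bullet> (tadjoint X \<star> Z)"
    by (simp add: inner_eq_Re_tinner tinner_tprod_left)
  show "(Y \<star> X) \<bullet> Z = Y \<bullet> (Z \<star> tadjoint X)"
    by (simp add: inner_eq_Re_tinner tinner_tprod_right)
qed (simp_all add: bounded_bilinear_tprod tprod_assoc tprod_tident_left tprod_tident_right)

text \<open>
  T-positivity quantifies over tensors with a single lateral slice, the algebra over square
  tensors. A square tensor is acted upon slice by slice.
\<close>

definition tcolumn :: "'n \<Rightarrow> ('m::finite, 'n::finite, 'p::finite) tensor \<Rightarrow> ('m, 1, 'p) tensor" where
  "tcolumn j A = (\<chi> k i _. A $ k $ i $ j)"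

lemma tprod_tcolumn: "A \<star> tcolumn j B = tcolumn j (A \<star> B)"
  by (simp add: vec_eq_iff tcolumn_def tprod_nth)

lemma tinner_eq_sum_tcolumn: "tinner A B = (\<Sum>j\<in>UNIV. tinner (tcolumn j A) (tcolumn j B))"
proof -
  have "tinner A B = (\<Sum>k\<in>UNIV. \<Sum>j\<in>UNIV. \<Sum>i\<in>UNIV. cnj (A $ k $ i $ j) * B $ k $ i $ j)"
    unfolding tinner_def by (intro sum.cong refl sum.swap)
  also have "\<dots> = (\<Sum>j\<in>UNIV. \<Sum>k\<in>UNIV. \<Sum>i\<in>UNIV. cnj (A $ k $ i $ j) * B $ k $ i $ j)"
    by (rule sum.swap)
  finally show ?thesis by (simp add: tinner_def tcolumn_def UNIV_1)
qed

lemma tinner_tprod_Hermitian_real: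
  assumes "A \<in> T_Hermitian"
  shows "tinner X (A \<star> X) \<in> \<real>"
proof -
  have "cnj (tinner X (A \<star> X)) = tinner X (A \<star> X)"
    using assms by (simp add: cnj_tinner tinner_tprod_left T_Hermitian_def)
  then show ?thesis by (simp add: Reals_cnj_iff)
qed

lemma T_posdef_eq:
  "(T_posdef :: ('n::finite, 'n, 'p::finite) tensor set) =
    {A \<in> T_Hermitian. \<forall>W :: ('n, 'n, 'p) tensor. W \<noteq> 0 \<longrightarrow> W \<bullet> (A \<star> W) > 0}"
proof -
  have split: "W \<bullet> (A \<star> W) = (\<Sum>j\<in>UNIV. Re (tinner (tcolumn j W) (A \<star> tcolumn j W)))"
    for A W :: "('n, 'n, 'p) tensor"
    by (simp add: inner_eq_Re_tinner tinner_eq_sum_tcolumn[of W] tprod_tcolumn)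
  have "(\<forall>X :: ('n, 1, 'p) tensor. X \<noteq> 0 \<longrightarrow> tinner X (A \<star> X) \<in> \<real> \<and> Re (tinner X (A \<star> X)) > 0) \<longleftrightarrow>
      (\<forall>W :: ('n, 'n, 'p) tensor. W \<noteq> 0 \<longrightarrow> W \<bullet> (A \<star> W) > 0)"
    (is "?columns \<longleftrightarrow> ?square") if A: "A \<in> T_Hermitian" for A :: "('n, 'n, 'p) tensor"
  proof
    assume cols: ?columns
    show ?square
    proof (intro allI impI)
      fix W :: "('n, 'n, 'p) tensor" assume "W \<noteq> 0"
      then obtain j where j: "tcolumn j W \<noteq> 0"
        by (auto simp: vec_eq_iff tcolumn_def)
      have "Re (tinner (tcolumn i W) (A \<star> tcolumn i W)) \<ge> 0" for i
        using cols by (cases "tcolumn i W = 0") (auto simp: tinner_def less_imp_le)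
      then show "W \<bullet> (A \<star> W) > 0"
        unfolding split using cols j by (intro sum_pos2[of _ j]) auto
    qed
  next
    assume square: ?square
    show ?columns
    proof (intro allI impI conjI)
      fix X :: "('n, 1, 'p) tensor" assume "X \<noteq> 0"
      define W :: "('n, 'n, 'p) tensor" where "W = (\<chi> k i _. X $ k $ i $ 1)"
      have col: "tcolumn j W = X" for j
        by (simp add: vec_eq_iff tcolumn_def W_def forall_1)
      have "tcolumn j (0 :: ('n, 'n, 'p) tensor) = 0" for j
        by (simp add: vec_eq_iff tcolumn_def)
      with col \<open>X \<noteq> 0\<close> have "W \<noteq> 0" by metis
      with square have "W \<bullet> (A \<star> W) > 0" by blast
      then show "Re (tinner X (A \<star> X)) > 0" unfolding split col by (simp add: zero_less_mult_iff)
      show "tinner X (A \<star> X) \<in> \<real>" by (rule tinner_tprod_Hermitian_real[OF A])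
    qed
  qed
  then show ?thesis unfolding T_posdef_def by blast
qed

text \<open>
  The block circulant matrix has \<open>p\<close> equal diagonal blocks.
\<close>

lemma ttrace_eq:
  fixes A :: "('n::finite, 'n, 'p::finite) tensor"
  shows "Re (ttrace A) = real CARD('p) * (tident \<bullet> A)"
proof -
  have "ttrace A = (\<Sum>k\<in>(UNIV :: 'p mod_ring set). \<Sum>i\<in>UNIV. A $ 0 $ i $ i)"
    by (simp add: ttrace_def trace_def bcirc_def
      sum_UNIV_prod)
  moreover have "tinner tident A = (\<Sum>k\<in>(UNIV :: 'p mod_ring set). if k = 0 then \<Sum>i\<in>UNIV. A $ 0 $ i $ i else 0)"
    unfolding tinner_def
  proof (rule sum.cong)
    fix k :: "'p mod_ring"
    have "cnj (mat 1 $ i $ j) * z = (if i = j then z else 0)" for i j :: 'n and z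
      by (simp add: mat_def)
    then show "(\<Sum>i\<in>UNIV. \<Sum>j\<in>UNIV. cnj (tident $ k $ i $ j) * A $ k $ i $ j) =
        (if k = 0 then \<Sum>i\<in>UNIV. A $ 0 $ i $ i else 0)"
      by (simp add: tident_def)
  qed simp
  ultimately show ?thesis by (simp add: inner_eq_Re_tinner)
qed

theorem corollary4p5:
  shows "riemannian_manifold (T_Hermitian :: ('n::finite, 'n, 'p::finite) tensor set) T_posdef trace_metric \<and>
    nonpositive_curvature (T_Hermitian :: ('n, 'n, 'p) tensor set) T_posdef trace_metric"
proof -
  interpret T: hilbert_algebra "(\<star>) :: ('n, 'n, 'p) tensor \<Rightarrow> _ \<Rightarrow> _" tident tadjoint "real CARD('p)"
    by (rule hilbert_algebra_tensor)
  have herm: "T.hermitian = T_Hermitian"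
    by (simp add: T.hermitian_def T_Hermitian_def)
  have pos: "T.posdef = T_posdef"
    by (simp add: T.posdef_def T_posdef_eq herm)
  have "T.ainv = tinv"
    by (simp add: fun_eq_iff T.ainv_def tinv_def)
  then have metric: "T.metric = trace_metric"
    by (simp add: fun_eq_iff T.metric_def trace_metric_def ttrace_eq T.tr_def)
  show ?thesis
    using T.riemannian_manifold_metric T.nonpositive_curvature_metric unfolding herm pos metric ..
qed

end
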